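(* Let $Q$ be an ordered groupoid and $\mathcal A$ a $Q$-module. An extension $\mathcal{A}\xrightarrow{\iota} G\xrightarrow{\varphi}Q$ is equivalent to an extension $\mathscr{E}_{\alpha}$ for some $\alpha \in \mathbf{OGpd}_{\mathbb{F}(Q)} (\mathbb{N}(Q), \mathcal{A})$.
   Context: **Ordered groupoids.** A groupoid $G$ is a small category with all morphisms invertible, composed left to right; identities are identified with objects and form the set $G_0$. For an arrow $g$, $g\mathbf d=gg^{-1}$ is its start and $g\mathbf r=g^{-1}g$ its end. An ordered groupoid is a groupoid with a partial order $\leq$ on arrows such that: (OG1) $x\leq y\Rightarrow x^{-1}\leq y^{-1}$; (OG2) if $x\leq y$, $u\leq v$ and $xu,yv$ exist then $xu\leq yv$; (OG3) if $e\in G_0$, $e\leq x\mathbf d$, there is a unique $(e|x)\leq x$ with $(e|x)\mathbf d=e$ (restriction); (OG4) if $e\in G_0$, $e\leq x\mathbf r$, there is a unique $(x|e)\leq x$ with $(x|e)\mathbf r=e$ (corestriction). Ordered functors are order-preserving functors. **Modules.** $\mathfrak L(G)$ is the category with objects $G_0$ and morphisms $(e,g)$, $e\in G_0$, $g\in G$, $g\mathbf d\leq e$, from $e$ to $g\mathbf r$, with $(e,g)(f,h)=(e,(g|h\mathbf d)h)$ when $g\mathbf r=f$. A $G$-module is a functor $\mathcal A:\mathfrak L(G)\to\mathbf{Ab}$, $e\mapsto A_e$, with actions $a\mapsto a\lhd(e,g)$; write $a\lhd g$ for $a\lhd(gg^{-1},g)$. A $Q$-module is regarded as an ordered groupoid: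 the disjoint union of the groups $A_e$ (written additively), with object poset $Q_0$ and $a'\leq a$ iff $a\in A_e$ and $a'=a\lhd(e,f)$ for some $f\in Q_0$, $f\leq e$. The semidirect product $Q\ltimes\mathcal A$ is the ordered groupoid with arrows $(q,a)$, $a\in A_{q\mathbf r}$, objects $Q_0$, $(q,a)\mathbf d=q\mathbf d$, $(q,a)\mathbf r=q\mathbf r$, $(g,a)(h,b)=(gh,(a\lhd h)+b)$ when $g\mathbf r=h\mathbf d$, and componentwise order. **Extensions.** An extension of $\mathcal A$ by $Q$ is an ordered groupoid $G$ with an ordered embedding $\iota:\mathcal A\to G$ and a surjective ordered functor $\varphi:G\to Q$ injective on identities, such that the image of $\iota$ is $\{g\in G:g\varphi\in Q_0\}$; here $\iota\varphi$ sends $a\in A_e$ to $e$, and conjugation in $G$ induces the given action: $g^{-1}(a\iota)g=(a\lhd g\varphi)\iota$ for $a\in A_{(gg^{-1})\varphi}$. Two extensions $G,H$ of $\mathcal A$ by $Q$ are equivalent if there is an ordered functor $G\to H$ commuting with the maps from $\mathcal A$ and to $Q$. **Quotients.** For a normal ordered subgroupoid $N$ of $S$ that is a union of groups, $g\simeq_N h$ iff $h=agb$ for some $a,b\in N$. The ordered groupoid $S/\!/N$ of $\simeq_N$-classes has $[g]\leq[h]$ iff $agb\leq h$ for some $a,b\in N$, and $[g][h]=[(g|pp^{-1})ph]$ for $p\in N$ with $pp^{-1}\leq g^{-1}g$, $p^{-1}p=hh^{-1}$. **The free ordered groupoid.** $\mathbb F(Q)$ is the free ordered groupoid on the underlying graph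 of $Q$, with object poset $Q_0$ and generators $\lfloor q\rfloor:q\mathbf d\to q\mathbf r$ ($q\in Q$). Explicitly, it is the free groupoid on the graph with vertex set $Q_0$ and one edge $(e|\lfloor q\rfloor)$ from $e$ to $(e|q)\mathbf r$ for each $q\in Q$ and $e\leq q\mathbf d$ in $Q_0$, with $\lfloor q\rfloor=(q\mathbf d|\lfloor q\rfloor)$; the order is by restriction of words, letter by letter, where $(e'|\lfloor q\rfloor)\leq(e|\lfloor q\rfloor)$ for $e'\leq e$. The ordered functor $\pi:\mathbb F(Q)\to Q$ is the identity on objects and sends $\lfloor q\rfloor\mapsto q$. Its kernel $\mathbb N(Q)=\{w:w\pi\in Q_0\}$ is a union of groups. $\mathcal A$ is an $\mathbb F(Q)$-module via $\pi$. $\mathbf{OGpd}_{\mathbb F(Q)}(\mathbb N(Q),\mathcal A)$ is the abelian group (under pointwise addition) of ordered functors $\phi:\mathbb N(Q)\to\mathcal A$, identity on objects, with $(h^{-1}wh)\phi=(w\phi)\lhd h$ for $h\in\mathbb F(Q)$, $w\in\mathbb N(Q)$ with $w\mathbf d=h\mathbf d$. **The extensions $\mathscr E_\alpha$.** Put $S=\mathbb F(Q)\ltimes\mathcal A$. For $\alpha\in\mathbf{OGpd}_{\mathbb F(Q)}(\mathbb N(Q),\mathcal A)$, $M_\alpha=\{(w,w\alpha):w\in\mathbb N(Q)\}$ is a normal ordered subgroupoid of $S$, and $\mathscr E_\alpha$ is the extension $\mathcal A\to S/\!/M_\alpha\to Q$ with maps $a\mapsto[(e,a)]$ ($a\in A_e$)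 and $[(x,a)]\mapsto x\pi$. *)

theory Defs
  imports "HOL-Algebra.Group"
begin

section \<open>Ordered groupoids\<close>

text \<open>A groupoid is given by its arrows alone, objects being identified with identity arrows.
  Composition is left to right: \<open>x \<cdot> y\<close> is meaningful when \<open>tgt x = src y\<close>.  The fields
  \<open>src\<close> and \<open>tgt\<close> are the maps written \<open>\<^bold>d\<close> and \<open>\<^bold>r\<close> in the literature.  All operations are
  unconstrained outside \<open>arr\<close>.\<close>

record 'a ogpd =
  arr :: "'a set"
  src :: "'a \<Rightarrow> 'a"
  tgt :: "'a \<Rightarrow> 'a"
  comp :: "'a \<Rightarrow> 'a \<Rightarrow> 'a" (infixl "\<cdot>\<index>" 70)
  ginv :: "'a \<Rightarrow> 'a"
  le :: "'a \<Rightarrow> 'a \<Rightarrow> bool" (infix "\<sqsubseteq>\<index>" 50)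

definition objs :: "'a ogpd \<Rightarrow> 'a set" where
  "objs G = {x \<in> arr G. src G x = x}"

locale groupoid =
  fixes G :: "'a ogpd" (structure)
  assumes src_obj: "x \<in> arr G \<Longrightarrow> src G x \<in> objs G"
    and tgt_obj: "x \<in> arr G \<Longrightarrow> tgt G x \<in> objs G"
    and tgt_of_obj: "e \<in> objs G \<Longrightarrow> tgt G e = e"
    and comp_closed: "\<lbrakk>x \<in> arr G; y \<in> arr G; tgt G x = src G y\<rbrakk> \<Longrightarrow> x \<cdot> y \<in> arr G"
    and src_comp: "\<lbrakk>x \<in> arr G; y \<in> arr G; tgt G x = src G y\<rbrakk> \<Longrightarrow> src G (x \<cdot> y) = src G x"
    and tgt_comp: "\<lbrakk>x \<in> arr G; y \<in> arr G; tgt G x = src G y\<rbrakk> \<Longrightarrow> tgt G (x \<cdot> y) = tgt G y"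
    and comp_assoc: "\<lbrakk>x \<in> arr G; y \<in> arr G; z \<in> arr G; tgt G x = src G y; tgt G y = src G z\<rbrakk>
        \<Longrightarrow> (x \<cdot> y) \<cdot> z = x \<cdot> (y \<cdot> z)"
    and src_unit: "x \<in> arr G \<Longrightarrow> src G x \<cdot> x = x"
    and tgt_unit: "x \<in> arr G \<Longrightarrow> x \<cdot> tgt G x = x"
    and ginv_closed: "x \<in> arr G \<Longrightarrow> ginv G x \<in> arr G"
    and src_ginv: "x \<in> arr G \<Longrightarrow> src G (ginv G x) = tgt G x"
    and tgt_ginv: "x \<in> arr G \<Longrightarrow> tgt G (ginv G x) = src G x"
    and comp_ginv: "x \<in> arr G \<Longrightarrow> x \<cdot> ginv G x = src G x"
    and ginv_comp: "x \<in> arr G \<Longrightarrow> ginv G x \<cdot> x = tgt G x"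

locale ordered_groupoid = groupoid +
  assumes le_refl: "x \<in> arr G \<Longrightarrow> x \<sqsubseteq> x"
    and le_antisym: "\<lbrakk>x \<in> arr G; y \<in> arr G; x \<sqsubseteq> y; y \<sqsubseteq> x\<rbrakk> \<Longrightarrow> x = y"
    and le_trans: "\<lbrakk>x \<in> arr G; y \<in> arr G; z \<in> arr G; x \<sqsubseteq> y; y \<sqsubseteq> z\<rbrakk> \<Longrightarrow> x \<sqsubseteq> z"
    and OG1: "\<lbrakk>x \<in> arr G; y \<in> arr G; x \<sqsubseteq> y\<rbrakk> \<Longrightarrow> ginv G x \<sqsubseteq> ginv G y"
    and OG2: "\<lbrakk>x \<in> arr G; y \<in> arr G; u \<in> arr G; v \<in> arr G; x \<sqsubseteq> y; u \<sqsubseteq> v;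
        tgt G x = src G u; tgt G y = src G v\<rbrakk> \<Longrightarrow> x \<cdot> u \<sqsubseteq> y \<cdot> v"
    and OG3: "\<lbrakk>x \<in> arr G; e \<in> objs G; e \<sqsubseteq> src G x\<rbrakk>
        \<Longrightarrow> \<exists>!y. y \<in> arr G \<and> y \<sqsubseteq> x \<and> src G y = e"
    and OG4: "\<lbrakk>x \<in> arr G; e \<in> objs G; e \<sqsubseteq> tgt G x\<rbrakk>
        \<Longrightarrow> \<exists>!y. y \<in> arr G \<and> y \<sqsubseteq> x \<and> tgt G y = e"

text \<open>The restriction \<open>(e|x)\<close> and the corestriction \<open>(x|e)\<close>.\<close>

definition rst :: "'a ogpd \<Rightarrow> 'a \<Rightarrow> 'a \<Rightarrow> 'a" where
  "rst G e x = (THE y. y \<in> arr G \<and> le G y x \<and> src G y = e)"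

definition corst :: "'a ogpd \<Rightarrow> 'a \<Rightarrow> 'a \<Rightarrow> 'a" where
  "corst G x e = (THE y. y \<in> arr G \<and> le G y x \<and> tgt G y = e)"

definition ordered_functor :: "'a ogpd \<Rightarrow> 'b ogpd \<Rightarrow> ('a \<Rightarrow> 'b) \<Rightarrow> bool" where
  "ordered_functor G H f \<longleftrightarrow>
     (\<forall>x \<in> arr G. f x \<in> arr H \<and> f (src G x) = src H (f x) \<and> f (tgt G x) = tgt H (f x)) \<and>
     (\<forall>x \<in> arr G. \<forall>y \<in> arr G. tgt G x = src G y \<longrightarrow> f (comp G x y) = comp H (f x) (f y)) \<and>
     (\<forall>x \<in> arr G. \<forall>y \<in> arr G. le G x y \<longrightarrow> le H (f x) (f y))"

definition ordered_embedding :: "'a ogpd \<Rightarrow> 'b ogpd \<Rightarrow> ('a \<Rightarrow> 'b) \<Rightarrow> bool" where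
  "ordered_embedding G H f \<longleftrightarrow> ordered_functor G H f \<and> inj_on f (arr G) \<and>
     (\<forall>x \<in> arr G. \<forall>y \<in> arr G. le H (f x) (f y) \<longrightarrow> le G x y)"


section \<open>Modules\<close>

text \<open>The category \<open>\<LL>(G)\<close>: the arrow \<open>(e, g)\<close> goes from \<open>e\<close> to \<open>tgt g\<close>.\<close>

definition L_arr :: "'a ogpd \<Rightarrow> ('a \<times> 'a) set" where
  "L_arr G = {(e, g). e \<in> objs G \<and> g \<in> arr G \<and> le G (src G g) e}"

fun L_comp :: "'a ogpd \<Rightarrow> 'a \<times> 'a \<Rightarrow> 'a \<times> 'a \<Rightarrow> 'a \<times> 'a" where
  "L_comp G (e, g) (f, h) = (e, comp G (corst G g (src G h)) h)"

text \<open>The abelian groups \<open>A\<^sub>e\<close> are groups in the sense of HOL-Algebra, hence written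
  multiplicatively.  Their carriers need not be disjoint.\<close>

record ('a, 'm) gmodule =
  fib :: "'a \<Rightarrow> 'm monoid"
  act :: "'m \<Rightarrow> 'a \<times> 'a \<Rightarrow> 'm"

definition is_gmodule :: "'a ogpd \<Rightarrow> ('a, 'm) gmodule \<Rightarrow> bool" where
  "is_gmodule G A \<longleftrightarrow>
     (\<forall>e \<in> objs G. comm_group (fib A e)) \<and>
     (\<forall>(e, g) \<in> L_arr G. (\<lambda>a. act A a (e, g)) \<in> hom (fib A e) (fib A (tgt G g))) \<and>
     (\<forall>e \<in> objs G. \<forall>a \<in> carrier (fib A e). act A a (e, e) = a) \<and>
     (\<forall>(e, g) \<in> L_arr G. \<forall>(f, h) \<in> L_arr G. tgt G g = f \<longrightarrow>
        (\<forall>a \<in> carrier (fib A e). act A a (L_comp G (e, g) (f, h)) = act A (act A a (e, g)) (f, h)))"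

definition lact :: "'a ogpd \<Rightarrow> ('a, 'm) gmodule \<Rightarrow> 'm \<Rightarrow> 'a \<Rightarrow> 'm" where
  "lact G A a g = act A a (src G g, g)"

text \<open>A module regarded as an ordered groupoid: the element \<open>a\<close> of \<open>A\<^sub>e\<close> is the arrow \<open>(e, a)\<close>.\<close>

definition mod_ogpd :: "'a ogpd \<Rightarrow> ('a, 'm) gmodule \<Rightarrow> ('a \<times> 'm) ogpd" where
  "mod_ogpd G A = \<lparr>
     arr = {(e, a). e \<in> objs G \<and> a \<in> carrier (fib A e)},
     src = (\<lambda>(e, a). (e, \<one>\<^bsub>fib A e\<^esub>)),
     tgt = (\<lambda>(e, a). (e, \<one>\<^bsub>fib A e\<^esub>)),
     comp = (\<lambda>(e, a) (f, b). (e, a \<otimes>\<^bsub>fib A e\<^esub> b)),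
     ginv = (\<lambda>(e, a). (e, inv\<^bsub>fib A e\<^esub> a)),
     le = (\<lambda>(f, a') (e, a). f \<in> objs G \<and> le G f e \<and> a' = act A a (e, f)) \<rparr>"

text \<open>The semidirect product, the object \<open>e\<close> being identified with the identity arrow \<open>(e, 0\<^sub>e)\<close>.\<close>

definition semidirect :: "'a ogpd \<Rightarrow> ('a, 'm) gmodule \<Rightarrow> ('a \<times> 'm) ogpd" where
  "semidirect G A = \<lparr>
     arr = {(g, a). g \<in> arr G \<and> a \<in> carrier (fib A (tgt G g))},
     src = (\<lambda>(g, a). (src G g, \<one>\<^bsub>fib A (src G g)\<^esub>)),
     tgt = (\<lambda>(g, a). (tgt G g, \<one>\<^bsub>fib A (tgt G g)\<^esub>)),
     comp = (\<lambda>(g, a) (h, b). (comp G g h, lact G A a h \<otimes>\<^bsub>fib A (tgt G h)\<^esub> b)),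
     ginv = (\<lambda>(g, a). (ginv G g, inv\<^bsub>fib A (src G g)\<^esub> (lact G A a (ginv G g)))),
     le = (\<lambda>(g, a) (h, b). le G g h \<and> le (mod_ogpd G A) (tgt G g, a) (tgt G h, b)) \<rparr>"

text \<open>A module over the codomain of an ordered functor \<open>p\<close>, regarded as a module over its domain.\<close>

definition pullback_mod :: "('b \<Rightarrow> 'a) \<Rightarrow> ('a, 'm) gmodule \<Rightarrow> ('b, 'm) gmodule" where
  "pullback_mod p A = \<lparr> fib = (\<lambda>e. fib A (p e)), act = (\<lambda>a (e, g). act A a (p e, p g)) \<rparr>"


section \<open>Extensions\<close>

definition extension ::
  "'q ogpd \<Rightarrow> ('q, 'm) gmodule \<Rightarrow> 'g ogpd \<Rightarrow> ('q \<times> 'm \<Rightarrow> 'g) \<Rightarrow> ('g \<Rightarrow> 'q) \<Rightarrow> bool" where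
  "extension Q A G \<iota> \<phi> \<longleftrightarrow>
     ordered_groupoid G \<and>
     ordered_embedding (mod_ogpd Q A) G \<iota> \<and>
     ordered_functor G Q \<phi> \<and> \<phi> ` arr G = arr Q \<and> inj_on \<phi> (objs G) \<and>
     \<iota> ` arr (mod_ogpd Q A) = {g \<in> arr G. \<phi> g \<in> objs Q} \<and>
     (\<forall>(e, a) \<in> arr (mod_ogpd Q A). \<phi> (\<iota> (e, a)) = e) \<and>
     (\<forall>g \<in> arr G. \<forall>a \<in> carrier (fib A (\<phi> (src G g))).
        comp G (comp G (ginv G g) (\<iota> (\<phi> (src G g), a))) g =
        \<iota> (\<phi> (tgt G g), lact Q A a (\<phi> g)))"

definition equivalent_extensions ::
  "'q ogpd \<Rightarrow> ('q, 'm) gmodule \<Rightarrow>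
   'g ogpd \<Rightarrow> ('q \<times> 'm \<Rightarrow> 'g) \<Rightarrow> ('g \<Rightarrow> 'q) \<Rightarrow>
   'h ogpd \<Rightarrow> ('q \<times> 'm \<Rightarrow> 'h) \<Rightarrow> ('h \<Rightarrow> 'q) \<Rightarrow> bool" where
  "equivalent_extensions Q A G \<iota> \<phi> H \<iota>' \<phi>' \<longleftrightarrow>
     extension Q A G \<iota> \<phi> \<and> extension Q A H \<iota>' \<phi>' \<and>
     (\<exists>f. ordered_functor G H f \<and>
          (\<forall>x \<in> arr (mod_ogpd Q A). f (\<iota> x) = \<iota>' x) \<and>
          (\<forall>g \<in> arr G. \<phi>' (f g) = \<phi> g))"


section \<open>Quotients\<close>

text \<open>These are meant for a normal ordered subgroupoid (with set of arrows) \<open>N\<close> of \<open>S\<close> that is a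
  union of groups.  Operations on classes are unions over all representatives; all the classes in
  such a union coincide, so the union is that common class.\<close>

definition quot_class :: "'s ogpd \<Rightarrow> 's set \<Rightarrow> 's \<Rightarrow> 's set" where
  "quot_class S N g = {h. \<exists>a \<in> N. \<exists>b \<in> N. tgt S a = src S g \<and> tgt S g = src S b \<and>
     h = comp S (comp S a g) b}"

definition quot_ogpd :: "'s ogpd \<Rightarrow> 's set \<Rightarrow> 's set ogpd" where
  "quot_ogpd S N = \<lparr>
     arr = quot_class S N ` arr S,
     src = (\<lambda>X. \<Union>g \<in> X. quot_class S N (src S g)),
     tgt = (\<lambda>X. \<Union>g \<in> X. quot_class S N (tgt S g)),
     comp = (\<lambda>X Y. \<Union>g \<in> X. \<Union>h \<in> Y.
       \<Union>p \<in> {p \<in> N. le S (src S p) (tgt S g) \<and> tgt S p = src S h}.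
         quot_class S N (comp S (comp S (corst S g (src S p)) p) h)),
     ginv = (\<lambda>X. \<Union>g \<in> X. quot_class S N (ginv S g)),
     le = (\<lambda>X Y. \<exists>g \<in> X. \<exists>h \<in> Y. \<exists>a \<in> N. \<exists>b \<in> N.
       tgt S a = src S g \<and> tgt S g = src S b \<and> le S (comp S (comp S a g) b) h) \<rparr>"


section \<open>The free ordered groupoid on the underlying graph\<close>

text \<open>The letters are the edges \<open>(e|\<lfloor>q\<rfloor>)\<close> and their formal inverses.\<close>

datatype 'q letter = Fwd 'q 'q | Bwd 'q 'q

fun letter_ok :: "'q ogpd \<Rightarrow> 'q letter \<Rightarrow> bool" where
  "letter_ok Q (Fwd e q) \<longleftrightarrow> q \<in> arr Q \<and> e \<in> objs Q \<and> le Q e (src Q q)"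
| "letter_ok Q (Bwd e q) \<longleftrightarrow> q \<in> arr Q \<and> e \<in> objs Q \<and> le Q e (src Q q)"

fun letter_src :: "'q ogpd \<Rightarrow> 'q letter \<Rightarrow> 'q" where
  "letter_src Q (Fwd e q) = e"
| "letter_src Q (Bwd e q) = tgt Q (rst Q e q)"

fun letter_inv :: "'q letter \<Rightarrow> 'q letter" where
  "letter_inv (Fwd e q) = Bwd e q"
| "letter_inv (Bwd e q) = Fwd e q"

abbreviation letter_tgt :: "'q ogpd \<Rightarrow> 'q letter \<Rightarrow> 'q" where
  "letter_tgt Q l \<equiv> letter_src Q (letter_inv l)"

fun letter_val :: "'q ogpd \<Rightarrow> 'q letter \<Rightarrow> 'q" where
  "letter_val Q (Fwd e q) = rst Q e q"
| "letter_val Q (Bwd e q) = ginv Q (rst Q e q)"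

fun letter_le :: "'q ogpd \<Rightarrow> 'q letter \<Rightarrow> 'q letter \<Rightarrow> bool" where
  "letter_le Q (Fwd e' q') (Fwd e q) \<longleftrightarrow> q' = q \<and> le Q e' e"
| "letter_le Q (Bwd e' q') (Bwd e q) \<longleftrightarrow> q' = q \<and> le Q e' e"
| "letter_le Q _ _ \<longleftrightarrow> False"

text \<open>A path is a start vertex together with a word of composable letters.\<close>

type_synonym 'q path = "'q \<times> 'q letter list"

fun is_path :: "'q ogpd \<Rightarrow> 'q path \<Rightarrow> bool" where
  "is_path Q (v, []) \<longleftrightarrow> v \<in> objs Q"
| "is_path Q (v, l # ls) \<longleftrightarrow> letter_ok Q l \<and> letter_src Q l = v \<and> is_path Q (letter_tgt Q l, ls)"

fun path_end :: "'q ogpd \<Rightarrow> 'q path \<Rightarrow> 'q" where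
  "path_end Q (v, []) = v"
| "path_end Q (v, l # ls) = path_end Q (letter_tgt Q l, ls)"

fun path_val :: "'q ogpd \<Rightarrow> 'q path \<Rightarrow> 'q" where
  "path_val Q (v, []) = v"
| "path_val Q (v, l # ls) = comp Q (letter_val Q l) (path_val Q (letter_tgt Q l, ls))"

definition path_rev :: "'q ogpd \<Rightarrow> 'q path \<Rightarrow> 'q path" where
  "path_rev Q p = (path_end Q p, map letter_inv (rev (snd p)))"

definition path_le :: "'q ogpd \<Rightarrow> 'q path \<Rightarrow> 'q path \<Rightarrow> bool" where
  "path_le Q u w \<longleftrightarrow> le Q (fst u) (fst w) \<and> list_all2 (letter_le Q) (snd u) (snd w)"

inductive cancel :: "'q ogpd \<Rightarrow> 'q path \<Rightarrow> 'q path \<Rightarrow> bool" for Q where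
  "is_path Q (v, us @ l # letter_inv l # ws) \<Longrightarrow> is_path Q (v, us @ ws) \<Longrightarrow>
   cancel Q (v, us @ l # letter_inv l # ws) (v, us @ ws)"

definition path_class :: "'q ogpd \<Rightarrow> 'q path \<Rightarrow> 'q path set" where
  "path_class Q p = {p'. equivclp (cancel Q) p p'}"

text \<open>The free groupoid on the graph of edges \<open>(e|\<lfloor>q\<rfloor>)\<close>: paths modulo insertion and deletion of
  subwords \<open>l l\<^sup>-\<^sup>1\<close>.  One class is below another if some representative of the first is a letter by
  letter restriction of some representative of the second.\<close>

definition free_ogpd :: "'q ogpd \<Rightarrow> 'q path set ogpd" where
  "free_ogpd Q = \<lparr>
     arr = path_class Q ` {p. is_path Q p},
     src = (\<lambda>X. \<Union>u \<in> X. path_class Q (fst u, [])),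
     tgt = (\<lambda>X. \<Union>u \<in> X. path_class Q (path_end Q u, [])),
     comp = (\<lambda>X Y. \<Union>u \<in> X. \<Union>w \<in> {w \<in> Y. path_end Q u = fst w}.
       path_class Q (fst u, snd u @ snd w)),
     ginv = (\<lambda>X. \<Union>u \<in> X. path_class Q (path_rev Q u)),
     le = (\<lambda>X Y. \<exists>u \<in> X. \<exists>w \<in> Y. path_le Q u w) \<rparr>"

text \<open>The identity of \<open>free_ogpd Q\<close> that is identified with the object \<open>e\<close> of \<open>Q\<close>.\<close>

definition free_id :: "'q ogpd \<Rightarrow> 'q \<Rightarrow> 'q path set" where
  "free_id Q e = path_class Q (e, [])"

definition free_pi :: "'q ogpd \<Rightarrow> 'q path set \<Rightarrow> 'q" where
  "free_pi Q X = the_elem (path_val Q ` X)"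

definition kernel :: "'q ogpd \<Rightarrow> 'q path set set" where
  "kernel Q = {w \<in> arr (free_ogpd Q). free_pi Q w \<in> objs Q}"

definition kernel_ogpd :: "'q ogpd \<Rightarrow> 'q path set ogpd" where
  "kernel_ogpd Q = (free_ogpd Q)\<lparr>arr := kernel Q\<rparr>"

text \<open>The underlying set of the group of equivariant ordered functors.  Only the values of \<open>\<alpha>\<close> on
  \<open>kernel Q\<close> matter.\<close>

definition kernel_homs :: "'q ogpd \<Rightarrow> ('q, 'm) gmodule \<Rightarrow> ('q path set \<Rightarrow> 'q \<times> 'm) set" where
  "kernel_homs Q A = {\<alpha>.
     ordered_functor (kernel_ogpd Q) (mod_ogpd Q A) \<alpha> \<and>
     (\<forall>e \<in> objs Q. \<alpha> (free_id Q e) = (e, \<one>\<^bsub>fib A e\<^esub>)) \<and>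
     (\<forall>h \<in> arr (free_ogpd Q). \<forall>w \<in> kernel Q. src (free_ogpd Q) w = src (free_ogpd Q) h \<longrightarrow>
        \<alpha> (comp (free_ogpd Q) (comp (free_ogpd Q) (ginv (free_ogpd Q) h) w) h) =
        (tgt Q (free_pi Q h), lact Q A (snd (\<alpha> w)) (free_pi Q h)))}"


section \<open>The extensions determined by equivariant ordered functors\<close>

definition free_semidirect :: "'q ogpd \<Rightarrow> ('q, 'm) gmodule \<Rightarrow> ('q path set \<times> 'm) ogpd" where
  "free_semidirect Q A = semidirect (free_ogpd Q) (pullback_mod (free_pi Q) A)"

definition graph_sub :: "'q ogpd \<Rightarrow> ('q path set \<Rightarrow> 'q \<times> 'm) \<Rightarrow> ('q path set \<times> 'm) set" where
  "graph_sub Q \<alpha> = {(w, snd (\<alpha> w)) | w. w \<in> kernel Q}"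

definition E_ogpd ::
  "'q ogpd \<Rightarrow> ('q, 'm) gmodule \<Rightarrow> ('q path set \<Rightarrow> 'q \<times> 'm) \<Rightarrow> ('q path set \<times> 'm) set ogpd" where
  "E_ogpd Q A \<alpha> = quot_ogpd (free_semidirect Q A) (graph_sub Q \<alpha>)"

definition E_iota ::
  "'q ogpd \<Rightarrow> ('q, 'm) gmodule \<Rightarrow> ('q path set \<Rightarrow> 'q \<times> 'm) \<Rightarrow>
   'q \<times> 'm \<Rightarrow> ('q path set \<times> 'm) set" where
  "E_iota Q A \<alpha> = (\<lambda>(e, a). quot_class (free_semidirect Q A) (graph_sub Q \<alpha>) (free_id Q e, a))"

definition E_phi :: "'q ogpd \<Rightarrow> ('q path set \<times> 'm) set \<Rightarrow> 'q" where
  "E_phi Q X = the_elem ((\<lambda>(x, a). free_pi Q x) ` X)"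

end

theory Submission
  imports Defs
begin

text \<open>Let \<open>\<iota>: \<A> \<rightarrow> G\<close> and \<open>\<phi>: G \<rightarrow> Q\<close> be an extension.  Since \<open>\<phi>\<close> is surjective, and
  an isomorphism between the posets of objects, every generator \<open>\<lfloor>q\<rfloor>\<close> can be sent to some arrow of
  \<open>G\<close> over \<open>q\<close>, and the universal property of \<open>\<F>(Q)\<close> turns this choice into an ordered functor \<open>\<psi>: \<F>(Q) \<rightarrow> G\<close> with
  \<open>\<psi>\<phi> = \<pi>\<close> (\<open>phi_psi\<close>).  On the kernel \<open>\<N>(Q)\<close> the functor \<open>\<psi>\<close> lands in the image of
  \<open>\<iota>\<close>; let \<open>w\<alpha>\<close> be the negative of the module element obtained.  As conjugation in \<open>G\<close> induces
  the action, \<open>\<alpha>\<close> is equivariant (\<open>alpha_kernel_hom\<close>).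

  The same conjugation condition makes \<open>\<Psi> (x, a) = \<psi> x \<cdot> \<iota> a\<close> an ordered functor from
  \<open>\<F>(Q) \<ltimes> \<A>\<close> to \<open>G\<close> (\<open>Psi_functor\<close>).  It is surjective, since any two arrows of \<open>G\<close> over the
  same \<open>q\<close> differ by an element of the module (\<open>Psi_surj\<close>), and \<open>(w, a)\<close> is sent to an identity exactly
  if \<open>w\<close> is in \<open>\<N>(Q)\<close> and \<open>a = w\<alpha>\<close> (\<open>graph_sub_kernel\<close>).  So the subgroupoid factored out in the
  construction of the extension of \<open>\<alpha>\<close> is the kernel of \<open>\<Psi>\<close>, and the quotient ought to be \<open>G\<close>.

  For ordered groupoids the first isomorphism theorem needs one more ingredient, since the order of the
  quotient is an image of the order upstairs.  It suffices that whenever \<open>g\<close> lies below \<open>\<Psi> y\<close>, some element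
  below \<open>y\<close> maps to \<open>g\<close> (\<open>Psi_le_lift\<close>); this follows because words can be restricted letter by letter
  (\<open>path_restriction\<close>) and restrictions in \<open>G\<close> are unique.  The quotient is then isomorphic to \<open>G\<close> by
  sending an arrow to its fibre (\<open>fibre_iso\<close>).  Finally, the isomorphism carries the axioms of
  an ordered groupoid and of an extension from \<open>G\<close> to the quotient (\<open>extension_transport\<close>),
  which takes the place of a direct verification for the quotient.\<close>

section \<open>Groupoids and ordered functors\<close>

context groupoid
begin

lemma obj_arr: "e \<in> objs G \<Longrightarrow> e \<in> arr G"
  by (simp add: objs_def)

lemma src_of_obj: "e \<in> objs G \<Longrightarrow> src G e = e"
  by (simp add: objs_def)

lemma ginv_comp_comp:
  assumes "x \<in> arr G" "y \<in> arr G" "tgt G x = src G y"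
  shows "ginv G x \<cdot> (x \<cdot> y) = y"
proof -
  have "ginv G x \<cdot> (x \<cdot> y) = (ginv G x \<cdot> x) \<cdot> y"
    using assms by (simp add: comp_assoc ginv_closed tgt_ginv)
  then show ?thesis using assms by (simp add: ginv_comp src_unit)
qed

lemma comp_ginv_comp:
  assumes "x \<in> arr G" "y \<in> arr G" "src G x = src G y"
  shows "x \<cdot> (ginv G x \<cdot> y) = y"
proof -
  have "x \<cdot> (ginv G x \<cdot> y) = (x \<cdot> ginv G x) \<cdot> y"
    using assms by (simp add: comp_assoc ginv_closed tgt_ginv src_ginv)
  then show ?thesis using assms by (simp add: comp_ginv src_unit)
qed

lemma ginv_unique:
  assumes "x \<in> arr G" "y \<in> arr G" "tgt G x = src G y" "x \<cdot> y = src G x"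
  shows "y = ginv G x"
proof -
  have "y = ginv G x \<cdot> src G x"
    using ginv_comp_comp[OF assms(1-3)] assms(4) by simp
  also have "\<dots> = ginv G x"
    using tgt_unit[OF ginv_closed[OF assms(1)]] assms(1) by (simp add: tgt_ginv)
  finally show ?thesis .
qed

lemma ginv_ginv: "x \<in> arr G \<Longrightarrow> ginv G (ginv G x) = x"
  using ginv_unique[of "ginv G x" x]
  by (simp add: ginv_closed src_ginv tgt_ginv ginv_comp)

lemma obj_comp_obj: "e \<in> objs G \<Longrightarrow> e \<cdot> e = e"
  using src_unit[of e] by (simp add: obj_arr src_of_obj)

end

context ordered_groupoid
begin

lemma src_mono:
  assumes "x \<in> arr G" "y \<in> arr G" "x \<sqsubseteq> y"
  shows "src G x \<sqsubseteq> src G y"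
  using OG2[OF assms(1,2) ginv_closed[OF assms(1)] ginv_closed[OF assms(2)] assms(3) OG1[OF assms]]
    assms by (simp add: comp_ginv src_ginv)

lemma tgt_mono:
  assumes "x \<in> arr G" "y \<in> arr G" "x \<sqsubseteq> y"
  shows "tgt G x \<sqsubseteq> tgt G y"
  using src_mono[OF ginv_closed[OF assms(1)] ginv_closed[OF assms(2)] OG1[OF assms]] assms
  by (simp add: src_ginv)

lemma below_eq_src:
  assumes "x \<in> arr G" "y \<in> arr G" "z \<in> arr G" "x \<sqsubseteq> z" "y \<sqsubseteq> z" "src G x = src G y"
  shows "x = y"
  using OG3[of z "src G x"] assms src_obj[of x] src_mono[of x z] by metis

lemma below_eq_tgt:
  assumes "x \<in> arr G" "y \<in> arr G" "z \<in> arr G" "x \<sqsubseteq> z" "y \<sqsubseteq> z" "tgt G x = tgt G y"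
  shows "x = y"
  using OG4[of z "tgt G x"] assms tgt_obj[of x] tgt_mono[of x z] by metis

lemma rst:
  assumes "x \<in> arr G" "e \<in> objs G" "e \<sqsubseteq> src G x"
  shows rst_arr: "rst G e x \<in> arr G" and rst_le: "rst G e x \<sqsubseteq> x"
    and src_rst: "src G (rst G e x) = e"
  using theI'[OF OG3[OF assms]] unfolding rst_def by auto

lemma rst_eqI:
  assumes "x \<in> arr G" "y \<in> arr G" "y \<sqsubseteq> x"
  shows "rst G (src G y) x = y"
  using below_eq_src[of "rst G (src G y) x" y x] rst[OF assms(1) src_obj[OF assms(2)]]
    src_mono[OF assms(2,1,3)] assms by simp

text \<open>Restricting in two stages from \<open>x\<close> to \<open>f\<close> to \<open>e\<close> gives an arrow below \<open>x\<close> that starts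
  at \<open>e\<close>, and there is only one such arrow.\<close>

lemma rst_mono:
  assumes "x \<in> arr G" "e \<in> objs G" "f \<in> objs G" "f \<sqsubseteq> src G x" "e \<sqsubseteq> f"
  shows "rst G e x \<sqsubseteq> rst G f x"
proof -
  have ex: "e \<sqsubseteq> src G x"
    using le_trans[of e f "src G x"] assms by (simp add: obj_arr src_obj)
  have f: "rst G f x \<in> arr G" "rst G f x \<sqsubseteq> x" "src G (rst G f x) = f"
    using rst assms by auto
  let ?y = "rst G e (rst G f x)"
  have y: "?y \<in> arr G" "?y \<sqsubseteq> rst G f x" "src G ?y = e"
    using rst[of "rst G f x" e] f assms by auto
  have "?y \<sqsubseteq> x" using le_trans[of ?y "rst G f x" x] y f assms by auto
  then have "rst G e x = ?y" using rst_eqI[of x ?y] y assms by simp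
  then show ?thesis using y by simp
qed

lemma corst_tgt: "x \<in> arr G \<Longrightarrow> corst G x (tgt G x) = x"
  unfolding corst_def
  by (rule the_equality) (auto intro: le_refl below_eq_tgt)

end

lemma ordered_functorD:
  assumes "ordered_functor G H f"
  shows "x \<in> arr G \<Longrightarrow> f x \<in> arr H"
    and "x \<in> arr G \<Longrightarrow> f (src G x) = src H (f x)"
    and "x \<in> arr G \<Longrightarrow> f (tgt G x) = tgt H (f x)"
    and "\<lbrakk>x \<in> arr G; y \<in> arr G; tgt G x = src G y\<rbrakk> \<Longrightarrow> f (comp G x y) = comp H (f x) (f y)"
    and "\<lbrakk>x \<in> arr G; y \<in> arr G; le G x y\<rbrakk> \<Longrightarrow> le H (f x) (f y)"
  using assms unfolding ordered_functor_def by blast+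

lemma ordered_functor_compose:
  assumes "ordered_functor G H f" "ordered_functor H K g"
  shows "ordered_functor G K (\<lambda>x. g (f x))"
proof -
  note f = ordered_functorD[OF assms(1)] and g = ordered_functorD[OF assms(2)]
  have "g (f (comp G x y)) = comp K (g (f x)) (g (f y))"
    if "x \<in> arr G" "y \<in> arr G" "tgt G x = src G y" for x y
    using that f(1,4) g(4)[of "f x" "f y"] f(3)[of x] f(2)[of y] by simp
  then show ?thesis unfolding ordered_functor_def by (simp add: f(1,2,3,5) g(1,2,3,5))
qed

lemma ordered_functor_cong:
  assumes "groupoid G" "ordered_functor G H f" "\<And>x. x \<in> arr G \<Longrightarrow> g x = f x"
  shows "ordered_functor G H g"
proof -
  interpret groupoid G by fact
  show ?thesis
    unfolding ordered_functor_def
    by (intro conjI ballI impI)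
       (simp_all add: assms(3) ordered_functorD[OF assms(2)] src_obj tgt_obj obj_arr comp_closed)
qed

lemma functor_obj:
  assumes "groupoid G" "groupoid H" "ordered_functor G H f" "e \<in> objs G"
  shows "f e \<in> objs H"
  using groupoid.src_obj[OF assms(2)] ordered_functorD(1,2)[OF assms(3), of e]
    groupoid.obj_arr[OF assms(1,4)] groupoid.src_of_obj[OF assms(1,4)] by metis

lemma functor_ginv:
  assumes "groupoid G" "groupoid H" "ordered_functor G H f" "x \<in> arr G"
  shows "f (ginv G x) = ginv H (f x)"
proof -
  interpret G: groupoid G by fact
  interpret H: groupoid H by fact
  note f = ordered_functorD[OF assms(3)]
  show ?thesis
  proof (rule H.ginv_unique)
    show "comp H (f x) (f (ginv G x)) = src H (f x)"
      using f(2)[of x] f(4)[of x "ginv G x"] assms(4)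
      by (simp add: G.ginv_closed G.src_ginv G.comp_ginv)
    show "tgt H (f x) = src H (f (ginv G x))"
      using f(3)[of x] f(2)[of "ginv G x"] assms(4) by (simp add: G.ginv_closed G.src_ginv)
  qed (use f(1) assms(4) G.ginv_closed in auto)
qed

section \<open>Letters and paths\<close>

lemma letter_inv_inv [simp]: "letter_inv (letter_inv l) = l"
  by (cases l) auto

lemma letter_ok_inv [simp]: "letter_ok Q (letter_inv l) = letter_ok Q l"
  by (cases l) auto

lemma letter_le_inv [simp]: "letter_le Q (letter_inv l') (letter_inv l) = letter_le Q l' l"
  by (cases l; cases l') auto

locale ogpd_paths = ordered_groupoid Q for Q :: "'q ogpd" (structure)
begin

lemma letter_val_arr: "letter_ok Q l \<Longrightarrow> letter_val Q l \<in> arr Q"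
  by (cases l) (auto simp: rst_arr ginv_closed)

lemma src_letter_val: "letter_ok Q l \<Longrightarrow> src Q (letter_val Q l) = letter_src Q l"
  by (cases l) (auto simp: src_rst rst_arr src_ginv)

lemma letter_val_inv: "letter_ok Q l \<Longrightarrow> letter_val Q (letter_inv l) = ginv Q (letter_val Q l)"
  by (cases l) (auto simp: rst_arr ginv_ginv)

lemma letter_src_obj: "letter_ok Q l \<Longrightarrow> letter_src Q l \<in> objs Q"
  using src_obj[OF letter_val_arr] src_letter_val by metis

lemma letter_val_mono:
  assumes "letter_ok Q l'" "letter_ok Q l" "letter_le Q l' l"
  shows "letter_val Q l' \<sqsubseteq> letter_val Q l"
  using assms by (cases l; cases l') (auto simp: rst_arr rst_mono OG1)

lemma letter_src_mono:
  assumes "letter_ok Q l'" "letter_ok Q l" "letter_le Q l' l"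
  shows "letter_src Q l' \<sqsubseteq> letter_src Q l"
  using src_mono[OF letter_val_arr letter_val_arr letter_val_mono] assms
  by (simp add: src_letter_val)

text \<open>For a forward letter the source is recorded in the letter.  The source of \<open>Bwd e q\<close> is the end
  of \<open>(e|q)\<close>, and \<open>e\<close> is recovered from it because corestrictions of \<open>q\<close> are unique.\<close>

lemma letter_le_same_src:
  assumes "letter_ok Q l'" "letter_ok Q l" "letter_le Q l' l" "letter_src Q l' = letter_src Q l"
  shows "l' = l"
proof (cases l)
  case (Fwd e q)
  then show ?thesis using assms by (cases l') auto
next
  case (Bwd e q)
  then obtain e' where l': "l' = Bwd e' q" using assms(3) by (cases l') auto
  have ok: "q \<in> arr Q" "e \<in> objs Q" "e \<sqsubseteq> src Q q" "e' \<in> objs Q" "e' \<sqsubseteq> src Q q"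
    using assms(1,2) Bwd l' by auto
  have "rst Q e' q = rst Q e q"
  proof (rule below_eq_tgt)
    show "tgt Q (rst Q e' q) = tgt Q (rst Q e q)" using assms(4) unfolding Bwd l' by simp
  qed (use ok rst in auto)
  then have "e' = e" using src_rst ok by metis
  then show ?thesis using Bwd l' by simp
qed

text \<open>A backward letter \<open>Bwd e q\<close> starts at the end of \<open>(e|q)\<close>, so it is restricted by
  corestricting \<open>(e|q)\<close>.\<close>

lemma letter_restriction:
  assumes "letter_ok Q l" "e \<in> objs Q" "e \<sqsubseteq> letter_src Q l"
  obtains l' where "letter_ok Q l'" "letter_le Q l' l" "letter_src Q l' = e"
proof (cases l)
  case (Fwd f q)
  have "e \<sqsubseteq> src Q q"
    using le_trans[of e f "src Q q"] assms Fwd by (simp add: obj_arr src_obj)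
  then show ?thesis using that[of "Fwd e q"] assms Fwd by simp
next
  case (Bwd f q)
  have ok: "q \<in> arr Q" "f \<in> objs Q" "f \<sqsubseteq> src Q q" using assms(1) Bwd by auto
  note r = rst[OF ok]
  obtain y where y: "y \<in> arr Q" "y \<sqsubseteq> rst Q f q" "tgt Q y = e"
    using OG4[OF r(1) assms(2)] assms(3) Bwd by auto
  have sy: "src Q y \<sqsubseteq> f" using src_mono[OF y(1) r(1) y(2)] r(3) by simp
  have "y \<sqsubseteq> q" using le_trans[OF y(1) r(1) ok(1) y(2) r(2)] .
  then have eq: "rst Q (src Q y) q = y" and "src Q y \<sqsubseteq> src Q q"
    using rst_eqI[OF ok(1) y(1)] src_mono[OF y(1) ok(1)] by auto
  then show ?thesis using that[of "Bwd (src Q y) q"] Bwd ok y sy by (simp add: src_obj)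
qed

lemma path_start_obj: "is_path Q p \<Longrightarrow> fst p \<in> objs Q"
  by (cases "(Q, p)" rule: is_path.cases) (auto simp: letter_src_obj)

lemma path_end_obj: "is_path Q p \<Longrightarrow> path_end Q p \<in> objs Q"
  by (induction Q p rule: is_path.induct) auto

lemma is_path_append:
  "is_path Q (v, us @ ws) \<longleftrightarrow> is_path Q (v, us) \<and> is_path Q (path_end Q (v, us), ws)"
  by (induction us arbitrary: v) (auto dest: path_start_obj)

lemma path_end_append: "path_end Q (v, us @ ws) = path_end Q (path_end Q (v, us), ws)"
  by (induction us arbitrary: v) auto

lemma is_path_single: "letter_ok Q l \<Longrightarrow> is_path Q (letter_src Q l, [l])"
  using letter_src_obj[of "letter_inv l"] by simp

lemma is_path_rev:
  assumes "is_path Q p"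
  shows "is_path Q (path_rev Q p)" "path_end Q (path_rev Q p) = fst p"
proof -
  have "is_path Q (path_rev Q (v, ls)) \<and> path_end Q (path_rev Q (v, ls)) = v"
    if "is_path Q (v, ls)" for v ls
    using that
  proof (induction ls arbitrary: v)
    case (Cons l ls)
    let ?r = "(path_end Q (letter_tgt Q l, ls), map letter_inv (rev ls))"
    have "is_path Q ?r" "path_end Q ?r = letter_tgt Q l"
      using Cons by (auto simp: path_rev_def)
    moreover have "is_path Q (letter_tgt Q l, [letter_inv l])"
      using is_path_single[of "letter_inv l"] Cons.prems by simp
    ultimately show ?case
      using Cons.prems by (simp add: path_rev_def is_path_append path_end_append)
  qed (auto simp: path_rev_def)
  from this[of "fst p" "snd p"] assms
  show "is_path Q (path_rev Q p)" "path_end Q (path_rev Q p) = fst p" by auto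
qed

lemma path_end_mono:
  assumes "is_path Q u" "is_path Q w" "path_le Q u w"
  shows "path_end Q u \<sqsubseteq> path_end Q w"
proof -
  have "path_end Q (v, us) \<sqsubseteq> path_end Q (v', ws)"
    if "list_all2 (letter_le Q) us ws" "is_path Q (v, us)" "is_path Q (v', ws)" "v \<sqsubseteq> v'"
    for v v' us ws
    using that
  proof (induction arbitrary: v v' rule: list_all2_induct)
    case (Cons l ls l' ls')
    then have "letter_tgt Q l \<sqsubseteq> letter_tgt Q l'"
      by (intro letter_src_mono) auto
    then show ?case using Cons by simp
  qed auto
  then show ?thesis using assms by (cases u; cases w) (auto simp: path_le_def)
qed

text \<open>Read from the end: the last letters have the same target, so they agree, so the second to last
  letters have the same target, and so on.\<close>

lemma path_le_same_end:
  assumes "is_path Q u" "is_path Q w" "path_le Q u w" "path_end Q u = path_end Q w"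
  shows "u = w"
proof -
  have "v = v' \<and> us = ws"
    if "list_all2 (letter_le Q) us ws" "is_path Q (v, us)" "is_path Q (v', ws)"
      "path_end Q (v, us) = path_end Q (v', ws)"
    for v v' us ws
    using that
  proof (induction arbitrary: v v' rule: list_all2_induct)
    case (Cons l ls l' ls')
    have "letter_tgt Q l = letter_tgt Q l'" and ls: "ls = ls'"
      using Cons.IH[of "letter_tgt Q l" "letter_tgt Q l'"] Cons.prems by auto
    then have "letter_inv l = letter_inv l'"
      using letter_le_same_src[of "letter_inv l" "letter_inv l'"] Cons.prems Cons.hyps by auto
    then have "l = l'" by (metis letter_inv_inv)
    then show ?case using ls Cons.prems by auto
  qed auto
  then show ?thesis using assms by (cases u; cases w) (auto simp: path_le_def)
qed

lemma path_restriction: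
  assumes "is_path Q w" "e \<in> objs Q" "e \<sqsubseteq> fst w"
  obtains u where "is_path Q u" "fst u = e" "path_le Q u w"
proof -
  have "\<exists>us. is_path Q (e, us) \<and> list_all2 (letter_le Q) us ws"
    if "is_path Q (v, ws)" "e \<in> objs Q" "e \<sqsubseteq> v" for v ws e
    using that
  proof (induction ws arbitrary: v e)
    case (Cons l ls)
    obtain l' where l': "letter_ok Q l'" "letter_le Q l' l" "letter_src Q l' = e"
      using letter_restriction[of l e] Cons.prems by auto
    have "letter_tgt Q l' \<sqsubseteq> letter_tgt Q l"
      using letter_src_mono[of "letter_inv l'" "letter_inv l"] l' Cons.prems by simp
    then obtain us where "is_path Q (letter_tgt Q l', us)" "list_all2 (letter_le Q) us ls"
      using Cons.IH[of "letter_tgt Q l" "letter_tgt Q l'"] Cons.prems l'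
        letter_src_obj[of "letter_inv l'"] by auto
    then show ?case using l' by (intro exI[of _ "l' # us"]) auto
  qed auto
  then show thesis using assms that by (cases w) (force simp: path_le_def)
qed

subsection \<open>Equivalence of paths\<close>

abbreviation path_eqv (infix "\<approx>" 50) where
  "u \<approx> w \<equiv> equivclp (cancel Q) u w"

lemma cancel_invariants:
  assumes "cancel Q u w"
  shows "fst u = fst w \<and> path_end Q u = path_end Q w \<and> is_path Q u \<and> is_path Q w"
  using assms by cases (auto simp: is_path_append path_end_append)

lemma eqv_invariants:
  assumes "u \<approx> w"
  shows "fst u = fst w" "path_end Q u = path_end Q w" "is_path Q u \<longleftrightarrow> is_path Q w"
proof -
  have "fst u = fst w \<and> path_end Q u = path_end Q w \<and> (is_path Q u \<longleftrightarrow> is_path Q w)"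
    using assms by induction (auto dest: cancel_invariants)
  then show "fst u = fst w" "path_end Q u = path_end Q w" "is_path Q u \<longleftrightarrow> is_path Q w"
    by auto
qed

text \<open>The hypothesis \<open>u \<approx> u'\<close> in \<open>f\<close> restricts attention to the words met on the way from \<open>u\<close> to
  \<open>w\<close>; these share their ends with \<open>u\<close>, which keeps the words built around them composable.\<close>

lemma eqv_map:
  assumes "u \<approx> w" and "is_path Q u"
    and f: "\<And>u' w'. cancel Q u' w' \<Longrightarrow> u \<approx> u' \<Longrightarrow> cancel Q (f u') (f w')"
  shows "f u \<approx> f w"
  using assms(1)
proof induction
  case (step y z)
  have "u \<approx> z" using step.hyps by (metis equivclp_into_equivclp)
  then have "cancel Q (f y) (f z) \<or> cancel Q (f z) (f y)"
    using step.hyps f by blast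
  then show ?case using step.IH by (metis equivclp_into_equivclp)
qed simp

lemma cancel_context:
  assumes "cancel Q (v, us) w" "is_path Q (v', xs @ us @ ys)" "path_end Q (v', xs) = v"
  shows "cancel Q (v', xs @ us @ ys) (v', xs @ snd w @ ys)"
  using assms(1)
proof cases
  case (1 us' l ws)
  have "is_path Q (v', xs @ us' @ ws @ ys)"
    using assms(2,3) 1 by (auto simp: is_path_append path_end_append)
  then show ?thesis
    using cancel.intros[of Q v' "xs @ us'" l "ws @ ys"] assms(2) 1 by simp
qed

lemma eqv_context:
  assumes "u \<approx> w" "is_path Q (v, xs @ snd u @ ys)" "path_end Q (v, xs) = fst u"
  shows "(v, xs @ snd u @ ys) \<approx> (v, xs @ snd w @ ys)"
proof (rule eqv_map[of u w "\<lambda>p. (v, xs @ snd p @ ys)", OF assms(1)])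
  have "is_path Q (path_end Q (v, xs), snd u)" using assms(2) by (simp add: is_path_append)
  then show u: "is_path Q u" using assms(3) by simp
  fix u' w' assume c: "cancel Q u' w'" and e: "u \<approx> u'"
  have "is_path Q (v, xs @ snd u' @ ys)"
    using eqv_invariants[OF e] u assms(2,3)
    by (auto simp: is_path_append) (metis prod.collapse)+
  then show "cancel Q (v, xs @ snd u' @ ys) (v, xs @ snd w' @ ys)"
    using cancel_context[of "fst u'" "snd u'" w' v xs ys] c eqv_invariants[OF e] assms(3) by simp
qed

lemma eqv_append:
  assumes "u \<approx> u'" "w \<approx> w'" "is_path Q u" "is_path Q w" "path_end Q u = fst w"
  shows "(fst u, snd u @ snd w) \<approx> (fst u', snd u' @ snd w')"
proof -
  have p: "is_path Q (fst u, snd u @ snd w)"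
    using assms by (auto simp: is_path_append)
  have "(fst u, [] @ snd u @ snd w) \<approx> (fst u, [] @ snd u' @ snd w)"
    using assms p by (intro eqv_context) auto
  moreover have "(fst u, snd u' @ snd w @ []) \<approx> (fst u, snd u' @ snd w' @ [])"
    using assms eqv_invariants[OF assms(1)]
    by (intro eqv_context) (auto simp: is_path_append)
  ultimately show ?thesis
    using eqv_invariants[OF assms(1)] by (auto intro: equivclp_trans)
qed

lemma eqv_rev:
  assumes "u \<approx> w" "is_path Q u"
  shows "path_rev Q u \<approx> path_rev Q w"
proof (rule eqv_map[OF assms])
  fix u' w' assume "cancel Q u' w'"
  then show "cancel Q (path_rev Q u') (path_rev Q w')"
  proof cases
    case (1 v us l ws)
    have e: "path_end Q u' = path_end Q w'"
      using cancel_invariants[OF \<open>cancel Q u' w'\<close>] by simp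
    show ?thesis
      using cancel.intros[of Q "path_end Q u'" "map letter_inv (rev ws)" l "map letter_inv (rev us)"]
        is_path_rev(1)[of u'] is_path_rev(1)[of w'] e 1
      by (simp add: path_rev_def)
  qed
qed

lemma path_comp_rev_eqv:
  assumes "is_path Q (v, ls)"
  shows "(v, ls @ map letter_inv (rev ls)) \<approx> (v, [])"
  using assms
proof (induction ls rule: rev_induct)
  case (snoc l ls)
  have p: "is_path Q (v, ls)" using snoc.prems by (simp add: is_path_append)
  have "cancel Q (v, ls @ l # letter_inv l # map letter_inv (rev ls))
      (v, ls @ map letter_inv (rev ls))"
    using is_path_rev(1)[OF p] is_path_rev(1)[OF snoc.prems] snoc.prems
    by (intro cancel.intros) (auto simp: is_path_append path_end_append path_rev_def)
  then have "(v, ls @ l # letter_inv l # map letter_inv (rev ls)) \<approx>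
      (v, ls @ map letter_inv (rev ls))"
    by (rule r_into_equivclp)
  then show ?case using snoc.IH[OF p] by (auto intro: equivclp_trans)
qed simp

end

section \<open>The free groupoid\<close>

lemma UN_const: "\<lbrakk>\<And>x. x \<in> X \<Longrightarrow> f x = c; X \<noteq> {}\<rbrakk> \<Longrightarrow> (\<Union>x \<in> X. f x) = c"
  by auto

lemma the_elem_image: "\<lbrakk>\<And>x. x \<in> X \<Longrightarrow> f x = c; X \<noteq> {}\<rbrakk> \<Longrightarrow> the_elem (f ` X) = c"
  by (metis image_cong image_constant_conv the_elem_eq)

context ogpd_paths
begin

abbreviation "F \<equiv> free_ogpd Q"

lemma path_class_eq_iff: "path_class Q u = path_class Q w \<longleftrightarrow> u \<approx> w"
  unfolding path_class_def by (auto intro: equivclp_trans equivclp_sym)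

lemma in_path_class: "w \<in> path_class Q u \<longleftrightarrow> u \<approx> w"
  by (simp add: path_class_def)

lemma path_class_self: "u \<in> path_class Q u"
  by (simp add: in_path_class)

lemma free_arrI: "is_path Q u \<Longrightarrow> path_class Q u \<in> arr F"
  by (simp add: free_ogpd_def)

lemma free_arrE:
  assumes "X \<in> arr F"
  obtains u where "is_path Q u" "X = path_class Q u"
  using assms by (auto simp: free_ogpd_def)

lemma UN_path_class:
  assumes "\<And>w. u \<approx> w \<Longrightarrow> f w = c"
  shows "(\<Union>w \<in> path_class Q u. f w) = c"
proof (rule UN_const)
  show "f w = c" if "w \<in> path_class Q u" for w
    using that assms by (simp add: in_path_class)
  show "path_class Q u \<noteq> {}" using path_class_self by blast
qed

lemma free_src: "src F (path_class Q u) = path_class Q (fst u, [])"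
proof -
  have "src F (path_class Q u) = (\<Union>w \<in> path_class Q u. path_class Q (fst w, []))"
    by (simp add: free_ogpd_def)
  also have "\<dots> = path_class Q (fst u, [])"
    by (rule UN_path_class) (auto dest: eqv_invariants(1))
  finally show ?thesis .
qed

lemma free_tgt: "tgt F (path_class Q u) = path_class Q (path_end Q u, [])"
proof -
  have "tgt F (path_class Q u) = (\<Union>w \<in> path_class Q u. path_class Q (path_end Q w, []))"
    by (simp add: free_ogpd_def)
  also have "\<dots> = path_class Q (path_end Q u, [])"
    by (rule UN_path_class) (auto dest: eqv_invariants(2))
  finally show ?thesis .
qed

lemma free_comp:
  assumes "is_path Q u" "is_path Q w" "path_end Q u = fst w"
  shows "comp F (path_class Q u) (path_class Q w) = path_class Q (fst u, snd u @ snd w)"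
proof -
  have eq: "path_class Q (fst u', snd u' @ snd w') = path_class Q (fst u, snd u @ snd w)"
    if "u \<approx> u'" "w \<approx> w'" for u' w'
    using eqv_append[of u u' w w'] that assms by (auto simp: path_class_eq_iff intro: equivclp_sym)
  have "comp F (path_class Q u) (path_class Q w) =
      (\<Union>u' \<in> path_class Q u. \<Union>w' \<in> {w' \<in> path_class Q w. path_end Q u' = fst w'}.
        path_class Q (fst u', snd u' @ snd w'))"
    by (simp add: free_ogpd_def)
  also have "\<dots> = path_class Q (fst u, snd u @ snd w)"
  proof (rule UN_path_class)
    fix u' assume u': "u \<approx> u'"
    have "{w' \<in> path_class Q w. path_end Q u' = fst w'} \<noteq> {}"
      using assms(3) path_class_self eqv_invariants(2)[OF u'] by fastforce
    then show "(\<Union>w' \<in> {w' \<in> path_class Q w. path_end Q u' = fst w'}.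
        path_class Q (fst u', snd u' @ snd w')) = path_class Q (fst u, snd u @ snd w)"
      by (intro UN_const) (simp_all add: in_path_class eq[OF u'])
  qed
  finally show ?thesis .
qed

lemma free_ginv:
  assumes "is_path Q u"
  shows "ginv F (path_class Q u) = path_class Q (path_rev Q u)"
proof -
  have "ginv F (path_class Q u) = (\<Union>w \<in> path_class Q u. path_class Q (path_rev Q w))"
    by (simp add: free_ogpd_def)
  also have "\<dots> = path_class Q (path_rev Q u)"
    by (rule UN_path_class)
       (use assms in \<open>auto simp: path_class_eq_iff intro: equivclp_sym eqv_rev\<close>)
  finally show ?thesis .
qed

lemma free_le_iff: "le F X Y \<longleftrightarrow> (\<exists>u \<in> X. \<exists>w \<in> Y. path_le Q u w)"
  by (simp add: free_ogpd_def)

lemma free_leI: "path_le Q u w \<Longrightarrow> le F (path_class Q u) (path_class Q w)"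
  using path_class_self[of u] path_class_self[of w] by (auto simp only: free_le_iff)

text \<open>Every member of the class of a path is a path, so any comparable members serve as
  representatives.\<close>

lemma free_leE:
  assumes "le F X Y" "X \<in> arr F" "Y \<in> arr F"
  obtains u w where "is_path Q u" "X = path_class Q u" "is_path Q w" "Y = path_class Q w"
    "path_le Q u w"
proof -
  have repr: "is_path Q v \<and> Z = path_class Q v" if "Z \<in> arr F" "v \<in> Z" for Z v
  proof -
    obtain u where u: "is_path Q u" "Z = path_class Q u" using \<open>Z \<in> arr F\<close> by (rule free_arrE)
    then have "u \<approx> v" using that(2) by (simp add: in_path_class)
    then show ?thesis using u eqv_invariants(3)[of u v] by (simp add: path_class_eq_iff)
  qed
  obtain u w where "u \<in> X" "w \<in> Y" "path_le Q u w" using assms(1) by (auto simp: free_le_iff)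
  then show thesis using that repr assms(2,3) by blast
qed

lemma identity_class_inj: "path_class Q (e, []) = path_class Q (f, []) \<longleftrightarrow> e = f"
  using eqv_invariants(1) by (auto simp: path_class_eq_iff)

lemma objs_free: "objs F = free_id Q ` objs Q"
proof
  show "objs F \<subseteq> free_id Q ` objs Q"
  proof
    fix X assume "X \<in> objs F"
    then have X: "X \<in> arr F" "src F X = X" by (auto simp: objs_def[of F])
    then obtain u where "is_path Q u" "X = path_class Q u" by (metis free_arrE)
    then show "X \<in> free_id Q ` objs Q"
      using X(2) path_start_obj[of u] by (auto simp: free_src free_id_def)
  qed
  show "free_id Q ` objs Q \<subseteq> objs F"
    unfolding free_id_def using free_src by (auto simp: objs_def[of F] intro: free_arrI)
qed

lemma free_composable_iff:
  "tgt F (path_class Q u) = src F (path_class Q w) \<longleftrightarrow> path_end Q u = fst w"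
  by (simp add: free_src free_tgt identity_class_inj)

lemma path_comp: "\<lbrakk>is_path Q u; is_path Q w; path_end Q u = fst w\<rbrakk>
    \<Longrightarrow> is_path Q (fst u, snd u @ snd w) \<and> path_end Q (fst u, snd u @ snd w) = path_end Q w"
  by (simp add: is_path_append path_end_append)

lemma free_groupoid: "groupoid F"
proof
  fix X assume X: "X \<in> arr F"
  then obtain u where u: "is_path Q u" "X = path_class Q u" by (rule free_arrE)
  note r = is_path_rev[OF u(1)] and s = path_start_obj[OF u(1)] and e = path_end_obj[OF u(1)]
  have rr: "path_rev Q (path_rev Q u) = u" "fst (path_rev Q u) = path_end Q u"
  proof (rule prod_eqI)
    show "fst (path_rev Q (path_rev Q u)) = fst u"
      using r(2) by (simp add: path_rev_def[of Q "path_rev Q u"])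
    show "snd (path_rev Q (path_rev Q u)) = snd u"
      by (simp add: path_rev_def rev_map o_def)
  qed (simp add: path_rev_def)
  show "src F X \<in> objs F" "tgt F X \<in> objs F"
    using u s e by (auto simp: free_src free_tgt objs_free free_id_def)
  show "comp F (src F X) X = X" "comp F X (tgt F X) = X"
    using u s e by (auto simp: free_src free_tgt free_comp)
  show "ginv F X \<in> arr F" using u r by (simp add: free_ginv free_arrI)
  show "src F (ginv F X) = tgt F X" "tgt F (ginv F X) = src F X"
    using u r rr by (simp_all add: free_ginv free_src free_tgt)
  have inv: "path_class Q (fst w, snd w @ snd (path_rev Q w)) = path_class Q (fst w, [])"
    if "is_path Q w" for w
    using path_comp_rev_eqv[of "fst w" "snd w"] that by (simp add: path_class_eq_iff path_rev_def)
  show "comp F X (ginv F X) = src F X"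
    using u r rr inv[OF u(1)] by (simp add: free_ginv free_src free_comp)
  show "comp F (ginv F X) X = tgt F X"
    using u r rr inv[OF r(1)] by (simp add: free_ginv free_tgt free_comp)
next
  fix E assume "E \<in> objs F"
  then show "tgt F E = E" by (auto simp: objs_free free_id_def free_tgt)
next
  fix X Y assume XY: "X \<in> arr F" "Y \<in> arr F" "tgt F X = src F Y"
  obtain u w where u: "is_path Q u" "X = path_class Q u" and w: "is_path Q w" "Y = path_class Q w"
    using XY(1,2) by (metis free_arrE)
  have c: "path_end Q u = fst w" using XY(3) u w by (simp add: free_composable_iff)
  note p = path_comp[OF u(1) w(1) c]
  show "comp F X Y \<in> arr F" "src F (comp F X Y) = src F X" "tgt F (comp F X Y) = tgt F Y"
    using u w c p by (auto simp: free_comp free_src free_tgt free_arrI)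
  fix Z assume Z: "Z \<in> arr F" "tgt F Y = src F Z"
  obtain z where z: "is_path Q z" "Z = path_class Q z" using Z(1) by (rule free_arrE)
  have d: "path_end Q w = fst z" using Z(2) w z by (simp add: free_composable_iff)
  show "comp F (comp F X Y) Z = comp F X (comp F Y Z)"
    using u w z c d p path_comp[OF w(1) z(1) d] by (simp add: free_comp)
qed

lemma free_le_refl: "X \<in> arr F \<Longrightarrow> le F X X"
proof (erule free_arrE)
  fix u assume u: "is_path Q u" "X = path_class Q u"
  have "letter_le Q l l" if "l \<in> set (snd u)" for l
  proof -
    have "letter_ok Q l" using u(1) that
      by (induction Q u rule: is_path.induct) auto
    then show ?thesis by (cases l) (auto intro: le_refl obj_arr)
  qed
  then have "path_le Q u u"
    using path_start_obj[OF u(1)] le_refl by (auto simp: path_le_def obj_arr intro!: list.rel_refl_strong)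
  then show "le F X X" using u free_leI by simp
qed

text \<open>Uniqueness of corestrictions along the full target.  Together with the existence of restrictions
  below, this is what the quotient construction asks of the order on words.\<close>

lemma free_below_eq_tgt:
  assumes "X \<in> arr F" "Y \<in> arr F" "le F X Y" "tgt F X = tgt F Y"
  shows "X = Y"
  using assms(3,1,2)
proof (rule free_leE)
  fix u w
  assume p: "is_path Q u" "X = path_class Q u" "is_path Q w" "Y = path_class Q w" "path_le Q u w"
  have "path_end Q u = path_end Q w"
    using assms(4) p by (simp add: free_tgt identity_class_inj)
  then show "X = Y" using path_le_same_end[OF p(1,3,5)] p(2,4) by simp
qed

lemma free_restriction:
  assumes "Y \<in> arr F" "e \<in> objs Q" "f \<in> objs Q" "src F Y = free_id Q f" "e \<sqsubseteq> f"
  obtains X where "X \<in> arr F" "le F X Y" "src F X = free_id Q e" "le F (tgt F X) (tgt F Y)"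
proof -
  obtain w where w: "is_path Q w" "Y = path_class Q w" using assms(1) by (rule free_arrE)
  have "fst w = f" using assms(4) w by (simp add: free_src free_id_def identity_class_inj)
  then obtain u where u: "is_path Q u" "fst u = e" "path_le Q u w"
    using path_restriction[OF w(1) assms(2)] assms(5) by auto
  have "le F (path_class Q u) Y" using u w free_leI by simp
  moreover have "path_le Q (path_end Q u, []) (path_end Q w, [])"
    using path_end_mono[OF u(1) w(1) u(3)] by (simp add: path_le_def)
  then have "le F (tgt F (path_class Q u)) (tgt F Y)"
    using w free_leI by (simp add: free_tgt)
  ultimately show thesis
    using that[of "path_class Q u"] u by (simp add: free_arrI free_src free_id_def)
qed

end

section \<open>The universal property of the free groupoid\<close>

text \<open>A monotone assignment of arrows of \<open>H\<close> to the letters, compatible with inversion, extends to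
  words by composing, and adjacent inverse letters cancel in \<open>H\<close>.  With \<open>H = Q\<close> this produces
  \<open>free_pi\<close>; with \<open>H\<close> an extension of \<open>Q\<close> it produces a lift of \<open>free_pi\<close>.\<close>

locale letter_assignment = ogpd_paths Q + H: ordered_groupoid H
  for Q :: "'q ogpd" (structure) and H :: "'h ogpd" +
  fixes ob :: "'q \<Rightarrow> 'h" and m :: "'q letter \<Rightarrow> 'h"
  assumes ob_obj: "e \<in> objs Q \<Longrightarrow> ob e \<in> objs H"
    and m_arr: "letter_ok Q l \<Longrightarrow> m l \<in> arr H"
    and src_m: "letter_ok Q l \<Longrightarrow> src H (m l) = ob (letter_src Q l)"
    and m_inv: "letter_ok Q l \<Longrightarrow> m (letter_inv l) = ginv H (m l)"
    and ob_mono: "\<lbrakk>e \<in> objs Q; f \<in> objs Q; e \<sqsubseteq> f\<rbrakk> \<Longrightarrow> le H (ob e) (ob f)"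
    and m_mono: "\<lbrakk>letter_ok Q l'; letter_ok Q l; letter_le Q l' l\<rbrakk> \<Longrightarrow> le H (m l') (m l)"
begin

fun word_val :: "'q \<Rightarrow> 'q letter list \<Rightarrow> 'h" where
  "word_val v [] = ob v"
| "word_val v (l # ls) = comp H (m l) (word_val (letter_tgt Q l) ls)"

definition free_ext :: "'q path set \<Rightarrow> 'h" where
  "free_ext X = the_elem ((\<lambda>u. word_val (fst u) (snd u)) ` X)"

lemma tgt_m: "letter_ok Q l \<Longrightarrow> tgt H (m l) = ob (letter_tgt Q l)"
  using src_m[of "letter_inv l"] m_inv[of l] m_arr[of l] by (simp add: H.src_ginv)

lemma word_val:
  assumes "is_path Q (v, ls)"
  shows "word_val v ls \<in> arr H" and "src H (word_val v ls) = ob v"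
    and "tgt H (word_val v ls) = ob (path_end Q (v, ls))"
proof -
  have "word_val v ls \<in> arr H \<and> src H (word_val v ls) = ob v \<and>
      tgt H (word_val v ls) = ob (path_end Q (v, ls))"
    using assms
  proof (induction ls arbitrary: v)
    case Nil
    then show ?case using ob_obj[of v] by (simp add: H.obj_arr H.src_of_obj H.tgt_of_obj)
  next
    case (Cons l ls)
    then show ?case
      using m_arr[of l] tgt_m[of l] src_m[of l]
      by (auto simp: H.comp_closed H.src_comp H.tgt_comp)
  qed
  then show "word_val v ls \<in> arr H" "src H (word_val v ls) = ob v"
    "tgt H (word_val v ls) = ob (path_end Q (v, ls))" by auto
qed

lemma word_val_append:
  assumes "is_path Q (v, us @ ws)"
  shows "word_val v (us @ ws) = comp H (word_val v us) (word_val (path_end Q (v, us)) ws)"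
  using assms
proof (induction us arbitrary: v)
  case Nil
  then show ?case
    using word_val[of v ws] H.src_unit[of "word_val v ws"] by simp
next
  case (Cons l us)
  have p: "is_path Q (letter_tgt Q l, us)" "is_path Q (path_end Q (letter_tgt Q l, us), ws)"
    "letter_ok Q l"
    using Cons.prems by (auto simp: is_path_append)
  show ?case
    using Cons word_val[OF p(1)] word_val[OF p(2)] m_arr[OF p(3)] tgt_m[OF p(3)]
    by (simp add: H.comp_assoc)
qed

lemma word_val_cancel:
  assumes "cancel Q u w"
  shows "word_val (fst u) (snd u) = word_val (fst w) (snd w)"
  using assms
proof cases
  case (1 v us l ws)
  let ?e = "path_end Q (v, us)"
  have p: "letter_ok Q l" "letter_src Q l = ?e" "is_path Q (v, us)" "is_path Q (?e, ws)"
    using 1 by (auto simp: is_path_append)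
  have "word_val ?e (l # letter_inv l # ws) = word_val ?e ws"
    using p word_val[OF p(4)] m_arr[OF p(1)] src_m[OF p(1)]
    by (simp add: m_inv H.comp_ginv_comp)
  then show ?thesis
    using 1 word_val_append[of v us ws] word_val_append[of v us "l # letter_inv l # ws"] by simp
qed

lemma free_ext_class: "free_ext (path_class Q u) = word_val (fst u) (snd u)"
proof -
  have const: "word_val (fst w) (snd w) = word_val (fst u) (snd u)" if "w \<in> path_class Q u" for w
    using that unfolding in_path_class
  proof induction
    case (step y z)
    then show ?case using word_val_cancel[of y z] word_val_cancel[of z y] by auto
  qed simp
  show ?thesis
    unfolding free_ext_def
    by (rule the_elem_image[OF const]) (use path_class_self in blast)+
qed

lemma free_ext_id: "free_ext (free_id Q e) = ob e"
  by (simp add: free_id_def free_ext_class)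

lemma word_val_mono:
  assumes "list_all2 (letter_le Q) us ws" "is_path Q (v, us)" "is_path Q (v', ws)" "v \<sqsubseteq> v'"
  shows "le H (word_val v us) (word_val v' ws)"
  using assms
proof (induction arbitrary: v v' rule: list_all2_induct)
  case (Cons l ls l' ls')
  have ok: "letter_ok Q l" "letter_ok Q l'" "is_path Q (letter_tgt Q l, ls)"
    "is_path Q (letter_tgt Q l', ls')"
    using Cons.prems by auto
  have "letter_tgt Q l \<sqsubseteq> letter_tgt Q l'"
    using letter_src_mono[of "letter_inv l" "letter_inv l'"] ok Cons.hyps by simp
  then have "le H (word_val (letter_tgt Q l) ls) (word_val (letter_tgt Q l') ls')"
    using Cons.IH ok by blast
  then show ?case
    using H.OG2 m_mono[OF ok(1,2)] Cons.hyps m_arr tgt_m ok word_val[OF ok(3)] word_val[OF ok(4)]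
    by simp
qed (auto intro: ob_mono)

lemma free_ext_functor: "ordered_functor F H free_ext"
  unfolding ordered_functor_def
proof (intro conjI ballI impI)
  fix X assume "X \<in> arr F"
  then obtain u where u: "is_path Q u" "X = path_class Q u" by (rule free_arrE)
  have "is_path Q (fst u, snd u)" using u(1) by simp
  note v = word_val[OF this]
  show "free_ext X \<in> arr H" "free_ext (src F X) = src H (free_ext X)"
    "free_ext (tgt F X) = tgt H (free_ext X)"
    using u v by (simp_all add: free_src free_tgt free_ext_class)
next
  fix X Y assume XY: "X \<in> arr F" "Y \<in> arr F"
  obtain u w where u: "is_path Q u" "X = path_class Q u" and w: "is_path Q w" "Y = path_class Q w"
    using XY by (metis free_arrE)
  show "free_ext (comp F X Y) = comp H (free_ext X) (free_ext Y)" if "tgt F X = src F Y"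
  proof -
    have c: "path_end Q u = fst w" using that u w by (simp add: free_composable_iff)
    show ?thesis
      using u w c path_comp[OF u(1) w(1) c] word_val_append[of "fst u" "snd u" "snd w"]
      by (simp add: free_comp free_ext_class)
  qed
  show "le H (free_ext X) (free_ext Y)" if "le F X Y"
    using that XY
  proof (rule free_leE)
    fix u w
    assume p: "is_path Q u" "X = path_class Q u" "is_path Q w" "Y = path_class Q w" "path_le Q u w"
    have "le H (word_val (fst u) (snd u)) (word_val (fst w) (snd w))"
      using word_val_mono p by (simp add: path_le_def)
    then show "le H (free_ext X) (free_ext Y)" using p by (simp add: free_ext_class)
  qed
qed

end

context ogpd_paths
begin

sublocale pi: letter_assignment Q Q "\<lambda>e. e" "letter_val Q"
  by unfold_locales (auto simp: letter_val_arr src_letter_val letter_val_inv letter_val_mono)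

lemma free_pi_eq: "free_pi Q = pi.free_ext"
proof -
  have "path_val Q (v, ls) = pi.word_val v ls" for v ls
    by (induction ls arbitrary: v) auto
  then have "path_val Q = (\<lambda>u. pi.word_val (fst u) (snd u))" by auto
  then show ?thesis unfolding free_pi_def[abs_def] pi.free_ext_def[abs_def] by simp
qed

lemma free_pi_functor: "ordered_functor F Q (free_pi Q)"
  using pi.free_ext_functor by (simp add: free_pi_eq)

lemma free_pi_id: "free_pi Q (free_id Q e) = e"
  by (simp add: free_pi_eq pi.free_ext_id)

end

section \<open>Modules and semidirect products\<close>

locale ogpd_module = ordered_groupoid Q for Q :: "'q ogpd" (structure) +
  fixes A :: "('q, 'm) gmodule"
  assumes gmodule: "is_gmodule Q A"
begin

lemma fib_group: "e \<in> objs Q \<Longrightarrow> comm_group (fib A e)"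
  using gmodule by (simp add: is_gmodule_def)

lemma act_hom: "(e, g) \<in> L_arr Q \<Longrightarrow> (\<lambda>a. act A a (e, g)) \<in> hom (fib A e) (fib A (tgt Q g))"
  using gmodule unfolding is_gmodule_def by fast

lemma lact_hom: "g \<in> arr Q \<Longrightarrow> (\<lambda>a. lact Q A a g) \<in> hom (fib A (src Q g)) (fib A (tgt Q g))"
  unfolding lact_def by (rule act_hom) (simp add: L_arr_def src_obj le_refl obj_arr)

lemma act_restriction_hom:
  "\<lbrakk>e \<in> objs Q; f \<in> objs Q; f \<sqsubseteq> e\<rbrakk> \<Longrightarrow> (\<lambda>a. act A a (e, f)) \<in> hom (fib A e) (fib A f)"
  using act_hom[of e f] by (simp add: L_arr_def obj_arr src_of_obj tgt_of_obj)

lemma lact_obj: "\<lbrakk>e \<in> objs Q; a \<in> carrier (fib A e)\<rbrakk> \<Longrightarrow> lact Q A a e = a"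
  using gmodule by (simp add: is_gmodule_def lact_def src_of_obj)

text \<open>The composite in the category \<open>\<LL>(Q)\<close> involves a corestriction of \<open>g\<close>, which is trivial when
  \<open>g\<close> ends exactly where \<open>h\<close> starts.\<close>

lemma lact_comp:
  assumes "g \<in> arr Q" "h \<in> arr Q" "tgt Q g = src Q h" "a \<in> carrier (fib A (src Q g))"
  shows "lact Q A a (g \<cdot> h) = lact Q A (lact Q A a g) h"
proof -
  have L: "(src Q g, g) \<in> L_arr Q" "(src Q h, h) \<in> L_arr Q"
    using assms by (simp_all add: L_arr_def src_obj le_refl obj_arr)
  have "\<forall>(e, g) \<in> L_arr Q. \<forall>(f, h) \<in> L_arr Q. tgt Q g = f \<longrightarrow>
      (\<forall>a \<in> carrier (fib A e). act A a (L_comp Q (e, g) (f, h)) = act A (act A a (e, g)) (f, h))"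
    using gmodule by (simp add: is_gmodule_def)
  then have "act A a (L_comp Q (src Q g, g) (src Q h, h)) = act A (act A a (src Q g, g)) (src Q h, h)"
    using L assms(3,4) by fast
  moreover have "corst Q g (src Q h) = g"
    using corst_tgt[OF assms(1)] assms(3) by simp
  ultimately show ?thesis
    using assms by (simp add: lact_def src_comp)
qed

end

lemma mod_arr_iff [simp]: "(e, a) \<in> arr (mod_ogpd Q A) \<longleftrightarrow> e \<in> objs Q \<and> a \<in> carrier (fib A e)"
  and mod_src [simp]: "src (mod_ogpd Q A) (e, a) = (e, \<one>\<^bsub>fib A e\<^esub>)"
  and mod_tgt [simp]: "tgt (mod_ogpd Q A) (e, a) = (e, \<one>\<^bsub>fib A e\<^esub>)"
  and mod_comp [simp]: "comp (mod_ogpd Q A) (e, a) (f, b) = (e, a \<otimes>\<^bsub>fib A e\<^esub> b)"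
  and mod_ginv [simp]: "ginv (mod_ogpd Q A) (e, a) = (e, inv\<^bsub>fib A e\<^esub> a)"
  and mod_le [simp]: "le (mod_ogpd Q A) (f, b) (e, a) \<longleftrightarrow> f \<in> objs Q \<and> le Q f e \<and> b = act A a (e, f)"
  by (simp_all add: mod_ogpd_def)

lemma (in ogpd_module) objs_mod: "x \<in> objs (mod_ogpd Q A) \<longleftrightarrow> (\<exists>e \<in> objs Q. x = (e, \<one>\<^bsub>fib A e\<^esub>))"
  using fib_group comm_group.axioms(2) group.is_monoid monoid.one_closed
  by (cases x) (fastforce simp: objs_def[of "mod_ogpd Q A"])

lemma (in ogpd_module) mod_groupoid: "groupoid (mod_ogpd Q A)"
proof -
  have "group (fib A e)" if "e \<in> objs Q" for e
    using fib_group[OF that] by (rule comm_group.axioms)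
  then show ?thesis
    by unfold_locales
       (auto simp: objs_mod group.is_monoid monoid.m_closed monoid.m_assoc monoid.l_one
         monoid.r_one monoid.one_closed group.inv_closed group.l_inv group.r_inv)
qed

lemma semidirect_groupoid:
  fixes K :: "'k ogpd" and M :: "('k, 'm) gmodule"
  assumes "groupoid K"
    and grp: "\<And>e. e \<in> objs K \<Longrightarrow> group (fib M e)"
    and hom: "\<And>g. g \<in> arr K \<Longrightarrow> (\<lambda>a. lact K M a g) \<in> hom (fib M (src K g)) (fib M (tgt K g))"
    and idt: "\<And>e a. \<lbrakk>e \<in> objs K; a \<in> carrier (fib M e)\<rbrakk> \<Longrightarrow> lact K M a e = a"
    and cmp: "\<And>g h a. \<lbrakk>g \<in> arr K; h \<in> arr K; tgt K g = src K h; a \<in> carrier (fib M (src K g))\<rbrakk>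
      \<Longrightarrow> lact K M a (comp K g h) = lact K M (lact K M a g) h"
  shows "groupoid (semidirect K M)"
proof -
  interpret K: groupoid K by fact
  let ?S = "semidirect K M"
  have gs: "group (fib M (src K g))" "group (fib M (tgt K g))" if "g \<in> arr K" for g
    using that grp K.src_obj K.tgt_obj by auto
  have closed: "lact K M a g \<in> carrier (fib M (tgt K g))"
    if "g \<in> arr K" "a \<in> carrier (fib M (src K g))" for a g
    using hom_in_carrier[OF hom] that by auto
  have one: "lact K M \<one>\<^bsub>fib M (src K g)\<^esub> g = \<one>\<^bsub>fib M (tgt K g)\<^esub>" if "g \<in> arr K" for g
    using hom_one[OF hom] gs that by auto
  have lact_mult: "lact K M (a \<otimes>\<^bsub>fib M (src K g)\<^esub> b) g = lact K M a g \<otimes>\<^bsub>fib M (tgt K g)\<^esub> lact K M b g"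
    if "g \<in> arr K" "a \<in> carrier (fib M (src K g))" "b \<in> carrier (fib M (src K g))" for a b g
    using hom_mult[OF hom] that by auto
  have lact_inv: "lact K M (inv\<^bsub>fib M (src K g)\<^esub> a) g = inv\<^bsub>fib M (tgt K g)\<^esub> lact K M a g"
    if "g \<in> arr K" "a \<in> carrier (fib M (src K g))" for a g
    using group_hom.hom_inv[of "fib M (src K g)" "fib M (tgt K g)" "\<lambda>a. lact K M a g" a]
      hom gs that by (auto simp: group_hom_def group_hom_axioms_def)
  have ends: "src K (src K g) = src K g" "tgt K (src K g) = src K g"
    "src K (tgt K g) = tgt K g" "tgt K (tgt K g) = tgt K g" if "g \<in> arr K" for g
    using that K.src_obj K.tgt_obj K.src_of_obj K.tgt_of_obj by auto
  have arr: "x \<in> arr ?S \<longleftrightarrow> fst x \<in> arr K \<and> snd x \<in> carrier (fib M (tgt K (fst x)))" for x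
    by (cases x) (simp add: semidirect_def)
  have src: "src ?S x = (src K (fst x), \<one>\<^bsub>fib M (src K (fst x))\<^esub>)"
    and tgt: "tgt ?S x = (tgt K (fst x), \<one>\<^bsub>fib M (tgt K (fst x))\<^esub>)"
    and inv: "ginv ?S x = (ginv K (fst x), inv\<^bsub>fib M (src K (fst x))\<^esub> (lact K M (snd x) (ginv K (fst x))))"
    for x by (cases x; simp add: semidirect_def)+
  have comp: "comp ?S x y = (comp K (fst x) (fst y),
      lact K M (snd x) (fst y) \<otimes>\<^bsub>fib M (tgt K (fst y))\<^esub> snd y)" for x y
    by (cases x; cases y; simp add: semidirect_def)
  have objs: "e \<in> objs ?S \<longleftrightarrow> (\<exists>v \<in> objs K. e = (v, \<one>\<^bsub>fib M v\<^esub>))" for e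
  proof
    assume "e \<in> objs ?S"
    then show "\<exists>v \<in> objs K. e = (v, \<one>\<^bsub>fib M v\<^esub>)"
      by (cases e) (auto simp: objs_def[of ?S] arr src K.src_obj dest!: K.src_obj)
  next
    assume "\<exists>v \<in> objs K. e = (v, \<one>\<^bsub>fib M v\<^esub>)"
    then show "e \<in> objs ?S"
      by (auto simp: objs_def[of ?S] arr src K.src_of_obj K.tgt_of_obj K.obj_arr
          intro!: monoid.one_closed group.is_monoid grp)
  qed
  have composable: "tgt K (fst x) = src K (fst y)" if "tgt ?S x = src ?S y" for x y
    using that by (simp add: src tgt)
  show ?thesis
  proof
    fix x assume "x \<in> arr ?S"
    then have x: "fst x \<in> arr K" "snd x \<in> carrier (fib M (tgt K (fst x)))" by (simp_all add: arr)
    note g = gs[OF x(1)] and i = K.ginv_closed[OF x(1)]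
    have a: "lact K M (snd x) (ginv K (fst x)) \<in> carrier (fib M (src K (fst x)))"
      using closed[OF i, of "snd x"] x by (simp add: K.src_ginv K.tgt_ginv)
    show "src ?S x \<in> objs ?S" "tgt ?S x \<in> objs ?S"
      using x by (auto simp: objs src tgt K.src_obj K.tgt_obj)
    show "comp ?S (src ?S x) x = x"
      using x g one[OF x(1)] by (simp add: comp src K.src_unit group.is_monoid monoid.l_one)
    show "comp ?S x (tgt ?S x) = x"
      using x g idt[OF K.tgt_obj] by (simp add: comp tgt ends K.tgt_unit group.is_monoid monoid.r_one)
    show "ginv ?S x \<in> arr ?S"
      using x g i a by (simp add: arr inv K.tgt_ginv group.inv_closed)
    show "src ?S (ginv ?S x) = tgt ?S x" "tgt ?S (ginv ?S x) = src ?S x"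
      using x by (simp_all add: src tgt inv K.src_ginv K.tgt_ginv)
    show "comp ?S x (ginv ?S x) = src ?S x"
      using x g a by (simp add: comp inv src K.tgt_ginv K.comp_ginv group.r_inv)
    have "lact K M (lact K M (snd x) (ginv K (fst x))) (fst x) = snd x"
      using cmp[of "ginv K (fst x)" "fst x" "snd x"] x i idt[OF K.tgt_obj]
      by (simp add: K.src_ginv K.tgt_ginv K.ginv_comp)
    then show "comp ?S (ginv ?S x) x = tgt ?S x"
      using x g a lact_inv[OF x(1) a] by (simp add: comp inv tgt K.ginv_comp group.l_inv)
  next
    fix e assume "e \<in> objs ?S"
    then show "tgt ?S e = e" by (auto simp: objs tgt K.tgt_of_obj)
  next
    fix x y assume xy: "x \<in> arr ?S" "y \<in> arr ?S" "tgt ?S x = src ?S y"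
    note c = composable[OF xy(3)]
    have x: "fst x \<in> arr K" "snd x \<in> carrier (fib M (tgt K (fst x)))"
      and y: "fst y \<in> arr K" "snd y \<in> carrier (fib M (tgt K (fst y)))"
      using xy by (simp_all add: arr)
    note g = gs[OF y(1)]
    have a: "lact K M (snd x) (fst y) \<in> carrier (fib M (tgt K (fst y)))"
      using closed x y c by simp
    show "comp ?S x y \<in> arr ?S" "src ?S (comp ?S x y) = src ?S x" "tgt ?S (comp ?S x y) = tgt ?S y"
      using x y c a g
      by (simp_all add: arr comp src tgt K.comp_closed K.src_comp K.tgt_comp group.is_monoid monoid.m_closed)
    fix z assume "z \<in> arr ?S" "tgt ?S y = src ?S z"
    then have z: "fst z \<in> arr K" "snd z \<in> carrier (fib M (tgt K (fst z)))"
      "tgt K (fst y) = src K (fst z)" using composable by (simp_all add: arr)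
    show "comp ?S (comp ?S x y) z = comp ?S x (comp ?S y z)"
      using x y z c a gs[OF z(1)] cmp[of "fst y" "fst z" "snd x"]
        closed[of "fst z" "lact K M (snd x) (fst y)"] closed[of "fst z" "snd y"]
        lact_mult[of "fst z" "lact K M (snd x) (fst y)" "snd y"]
      by (simp add: comp K.comp_assoc K.tgt_comp group.is_monoid monoid.m_assoc)
  qed
qed

section \<open>Isomorphisms and transport of extensions\<close>

definition ogpd_iso :: "'a ogpd \<Rightarrow> 'b ogpd \<Rightarrow> ('a \<Rightarrow> 'b) \<Rightarrow> bool" where
  "ogpd_iso G H f \<longleftrightarrow> bij_betw f (arr G) (arr H) \<and>
     (\<forall>x \<in> arr G. src H (f x) = f (src G x) \<and> tgt H (f x) = f (tgt G x) \<and>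
        ginv H (f x) = f (ginv G x)) \<and>
     (\<forall>x \<in> arr G. \<forall>y \<in> arr G. tgt G x = src G y \<longrightarrow> comp H (f x) (f y) = f (comp G x y)) \<and>
     (\<forall>x \<in> arr G. \<forall>y \<in> arr G. le H (f x) (f y) \<longleftrightarrow> le G x y)"

lemma extensionD:
  assumes "extension Q A G \<iota> \<phi>"
  shows "ordered_functor (mod_ogpd Q A) G \<iota>" and "inj_on \<iota> (arr (mod_ogpd Q A))"
    and "\<And>x y. \<lbrakk>x \<in> arr (mod_ogpd Q A); y \<in> arr (mod_ogpd Q A); le G (\<iota> x) (\<iota> y)\<rbrakk>
      \<Longrightarrow> le (mod_ogpd Q A) x y"
    and "ordered_functor G Q \<phi>" and "\<phi> ` arr G = arr Q" and "inj_on \<phi> (objs G)"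
    and "\<iota> ` arr (mod_ogpd Q A) = {g \<in> arr G. \<phi> g \<in> objs Q}"
    and "\<And>e a. (e, a) \<in> arr (mod_ogpd Q A) \<Longrightarrow> \<phi> (\<iota> (e, a)) = e"
    and "\<And>g a. \<lbrakk>g \<in> arr G; a \<in> carrier (fib A (\<phi> (src G g)))\<rbrakk> \<Longrightarrow>
      comp G (comp G (ginv G g) (\<iota> (\<phi> (src G g), a))) g = \<iota> (\<phi> (tgt G g), lact Q A a (\<phi> g))"
  using assms unfolding extension_def ordered_embedding_def by fast+

locale ogpd_isomorphism = G: ordered_groupoid G for G :: "'g ogpd" +
  fixes H :: "'h ogpd" and f :: "'g \<Rightarrow> 'h"
  assumes iso: "ogpd_iso G H f"
begin

lemma arr_H: "arr H = f ` arr G"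
  using iso by (auto simp: ogpd_iso_def bij_betw_def)

lemma f_eq_iff: "\<lbrakk>x \<in> arr G; y \<in> arr G\<rbrakk> \<Longrightarrow> f x = f y \<longleftrightarrow> x = y"
  using iso by (auto simp: ogpd_iso_def bij_betw_def inj_on_def)

lemma f_ops:
  "x \<in> arr G \<Longrightarrow> src H (f x) = f (src G x)"
  "x \<in> arr G \<Longrightarrow> tgt H (f x) = f (tgt G x)"
  "x \<in> arr G \<Longrightarrow> ginv H (f x) = f (ginv G x)"
  "\<lbrakk>x \<in> arr G; y \<in> arr G; tgt G x = src G y\<rbrakk> \<Longrightarrow> comp H (f x) (f y) = f (comp G x y)"
  "\<lbrakk>x \<in> arr G; y \<in> arr G\<rbrakk> \<Longrightarrow> le H (f x) (f y) \<longleftrightarrow> le G x y"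
  using iso by (auto simp: ogpd_iso_def)

lemma src_tgt_arr: "x \<in> arr G \<Longrightarrow> src G x \<in> arr G" "x \<in> arr G \<Longrightarrow> tgt G x \<in> arr G"
  using G.src_obj G.tgt_obj G.obj_arr by auto

lemma objs_H: "objs H = f ` objs G"
  unfolding objs_def arr_H by (auto simp: f_ops f_eq_iff src_tgt_arr)

lemma composable_H: "\<lbrakk>x \<in> arr G; y \<in> arr G\<rbrakk> \<Longrightarrow> tgt H (f x) = src H (f y) \<longleftrightarrow> tgt G x = src G y"
  by (simp add: f_ops f_eq_iff src_tgt_arr)

lemmas f_simps = f_ops f_eq_iff composable_H src_tgt_arr G.comp_closed G.ginv_closed G.obj_arr
  G.src_of_obj G.tgt_of_obj

lemma ordered_groupoid_H: "ordered_groupoid H"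
proof
  fix x assume "x \<in> arr H"
  then obtain a where a: "a \<in> arr G" "x = f a" by (auto simp: arr_H)
  then show "src H x \<in> objs H" "tgt H x \<in> objs H" "comp H (src H x) x = x" "comp H x (tgt H x) = x"
    "ginv H x \<in> arr H" "src H (ginv H x) = tgt H x" "tgt H (ginv H x) = src H x"
    "comp H x (ginv H x) = src H x" "comp H (ginv H x) x = tgt H x" "le H x x"
    by (auto simp: f_simps objs_H arr_H G.src_obj G.tgt_obj G.src_unit G.tgt_unit
        G.src_ginv G.tgt_ginv G.comp_ginv G.ginv_comp G.le_refl)
  fix e assume e: "e \<in> objs H"
  then obtain b where b: "b \<in> objs G" "e = f b" by (auto simp: objs_H)
  show "\<exists>!y. y \<in> arr H \<and> le H y x \<and> src H y = e" if "le H e (src H x)"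
  proof -
    have "le G b (src G a)" using that a b by (simp add: f_simps)
    from G.OG3[OF a(1) b(1) this] obtain y where y: "y \<in> arr G" "le G y a" "src G y = b"
      "\<And>z. z \<in> arr G \<and> le G z a \<and> src G z = b \<Longrightarrow> z = y" by blast
    show ?thesis
    proof (rule ex1I)
      show "f y \<in> arr H \<and> le H (f y) x \<and> src H (f y) = e"
        using y(1-3) a b by (simp add: f_simps arr_H)
      fix z assume z: "z \<in> arr H \<and> le H z x \<and> src H z = e"
      then obtain c where "c \<in> arr G" "z = f c" by (auto simp: arr_H)
      then show "z = f y" using z a b y(4)[of c] by (simp add: f_simps)
    qed
  qed
  show "\<exists>!y. y \<in> arr H \<and> le H y x \<and> tgt H y = e" if "le H e (tgt H x)"
  proof -
    have "le G b (tgt G a)" using that a b by (simp add: f_simps)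
    from G.OG4[OF a(1) b(1) this] obtain y where y: "y \<in> arr G" "le G y a" "tgt G y = b"
      "\<And>z. z \<in> arr G \<and> le G z a \<and> tgt G z = b \<Longrightarrow> z = y" by blast
    show ?thesis
    proof (rule ex1I)
      show "f y \<in> arr H \<and> le H (f y) x \<and> tgt H (f y) = e"
        using y(1-3) a b by (simp add: f_simps arr_H)
      fix z assume z: "z \<in> arr H \<and> le H z x \<and> tgt H z = e"
      then obtain c where "c \<in> arr G" "z = f c" by (auto simp: arr_H)
      then show "z = f y" using z a b y(4)[of c] by (simp add: f_simps)
    qed
  qed
next
  fix e assume "e \<in> objs H"
  then show "tgt H e = e" by (auto simp: objs_H f_simps)
next
  fix x y assume "x \<in> arr H" "y \<in> arr H"
  then obtain a b where a: "a \<in> arr G" "x = f a" and b: "b \<in> arr G" "y = f b"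
    by (auto simp: arr_H)
  show "comp H x y \<in> arr H" "src H (comp H x y) = src H x" "tgt H (comp H x y) = tgt H y"
    if "tgt H x = src H y"
  proof -
    have "tgt G a = src G b" using that a b by (simp add: composable_H)
    then show "comp H x y \<in> arr H" "src H (comp H x y) = src H x" "tgt H (comp H x y) = tgt H y"
      using a b by (auto simp: f_ops G.comp_closed G.src_comp G.tgt_comp arr_H)
  qed
  show "x = y" if "le H x y" "le H y x"
    using that a b G.le_antisym[of a b] by (simp add: f_ops)
  show "le H (ginv H x) (ginv H y)" if "le H x y"
    using that a b by (simp add: f_simps G.OG1)
  fix z assume "z \<in> arr H"
  then obtain c where c: "c \<in> arr G" "z = f c" by (auto simp: arr_H)
  show "comp H (comp H x y) z = comp H x (comp H y z)" if "tgt H x = src H y" "tgt H y = src H z"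
  proof -
    have "tgt G a = src G b" "tgt G b = src G c" using that a b c by (simp_all add: composable_H)
    then show ?thesis
      using a b c by (simp add: f_ops G.comp_closed G.src_comp G.tgt_comp G.comp_assoc)
  qed
  show "le H x z" if "le H x y" "le H y z"
    using that a b c G.le_trans[of a b c] by (simp add: f_ops)
  fix v assume "v \<in> arr H" "le H x y" "le H z v" "tgt H x = src H z" "tgt H y = src H v"
  moreover from this obtain d where d: "d \<in> arr G" "v = f d" by (auto simp: arr_H)
  ultimately show "le H (comp H x z) (comp H y v)"
    using a b c G.OG2[of a b c d] by (simp add: f_ops f_eq_iff src_tgt_arr G.comp_closed)
qed

lemma functor_f: "ordered_functor G H f"
  unfolding ordered_functor_def by (auto simp: f_simps arr_H)

text \<open>An extension can be carried along an isomorphism \<open>f\<close> of ordered groupoids that matches the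
  structure maps; then \<open>f\<close> is itself an equivalence.  Applied to the isomorphism from a given extension
  to a quotient, this yields at once that the quotient is an ordered groupoid and an extension.\<close>

lemma extension_transport:
  fixes Q :: "'q ogpd" and A :: "('q, 'm) gmodule"
  assumes ext: "extension Q A G \<iota> \<phi>"
    and iota: "\<And>x. x \<in> arr (mod_ogpd Q A) \<Longrightarrow> \<iota>' x = f (\<iota> x)"
    and phi: "\<And>g. g \<in> arr G \<Longrightarrow> \<phi>' (f g) = \<phi> g"
    and "groupoid (mod_ogpd Q A)" and mod: "is_gmodule Q A" and "ordered_groupoid Q"
  shows "equivalent_extensions Q A G \<iota> \<phi> H \<iota>' \<phi>'"
proof -
  let ?M = "mod_ogpd Q A"
  interpret M: groupoid ?M by fact
  interpret Q: ogpd_module Q A by (intro ogpd_module.intro ogpd_module_axioms.intro assms)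
  note i = extensionD(1-3)[OF ext] and p = extensionD(4-6)[OF ext] and ker = extensionD(7)[OF ext]
    and pi = extensionD(8)[OF ext] and conj = extensionD(9)[OF ext]
  note iD = ordered_functorD[OF i(1)] and pD = ordered_functorD[OF p(1)]
  have "ordered_functor ?M H \<iota>'"
    using ordered_functor_cong[OF M.groupoid_axioms ordered_functor_compose[OF i(1) functor_f]] iota
    by simp
  moreover have "inj_on \<iota>' (arr ?M)"
    using i(2) by (auto simp: inj_on_def iota f_eq_iff iD(1))
  moreover have "le ?M x y" if "x \<in> arr ?M" "y \<in> arr ?M" "le H (\<iota>' x) (\<iota>' y)" for x y
    using that i(3) by (simp add: iota f_ops iD(1))
  ultimately have emb: "ordered_embedding ?M H \<iota>'"
    unfolding ordered_embedding_def by blast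
  have phi_functor: "ordered_functor H Q \<phi>'"
    unfolding ordered_functor_def arr_H
    by (auto simp: f_ops phi pD src_tgt_arr f_eq_iff G.comp_closed)
  have surj: "\<phi>' ` arr H = arr Q"
    using p(2) phi by (auto simp: arr_H image_image)
  have inj: "inj_on \<phi>' (objs H)"
    using p(3) by (auto simp: objs_H inj_on_def phi G.obj_arr)
  have ker': "\<iota>' ` arr ?M = {h \<in> arr H. \<phi>' h \<in> objs Q}"
  proof -
    have "\<iota>' ` arr ?M = f ` \<iota> ` arr ?M" using iota by (auto simp: image_image)
    also have "\<dots> = {h \<in> arr H. \<phi>' h \<in> objs Q}" unfolding ker by (auto simp: arr_H phi)
    finally show ?thesis .
  qed
  have pi': "\<phi>' (\<iota>' (e, a)) = e" if "(e, a) \<in> arr ?M" for e a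
    using that by (simp add: iota phi iD(1) pi)
  have conj': "comp H (comp H (ginv H h) (\<iota>' (\<phi>' (src H h), a))) h =
      \<iota>' (\<phi>' (tgt H h), lact Q A a (\<phi>' h))"
    if "h \<in> arr H" "a \<in> carrier (fib A (\<phi>' (src H h)))" for h a
  proof -
    obtain g where g: "g \<in> arr G" "h = f g" using \<open>h \<in> arr H\<close> by (auto simp: arr_H)
    have e: "\<phi>' (src H h) = \<phi> (src G g)" "\<phi>' (tgt H h) = \<phi> (tgt G g)" "\<phi>' h = \<phi> g"
      using g by (simp_all add: f_ops phi src_tgt_arr)
    have q: "\<phi> g \<in> arr Q" "\<phi> (src G g) = src Q (\<phi> g)" "\<phi> (tgt G g) = tgt Q (\<phi> g)"
      using pD g by auto
    let ?x = "(\<phi> (src G g), a)" and ?y = "(\<phi> (tgt G g), lact Q A a (\<phi> g))"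
    have a: "a \<in> carrier (fib A (\<phi> (src G g)))" using that(2) e by simp
    have x: "?x \<in> arr ?M" "?y \<in> arr ?M"
      using a q hom_in_carrier[OF Q.lact_hom[OF q(1)]]
      by (simp_all add: mod_ogpd_def Q.src_obj Q.tgt_obj)
    have ix: "\<iota> ?x \<in> arr G" "src G (\<iota> ?x) = src G g" "tgt G (\<iota> ?x) = src G g"
    proof -
      show ix: "\<iota> ?x \<in> arr G" using iD(1) x by blast
      have "\<phi> (src G (\<iota> ?x)) = \<phi> (src G g)" "\<phi> (tgt G (\<iota> ?x)) = \<phi> (src G g)"
        using pD(2,3)[OF ix] pi[OF x(1)] q Q.src_obj[OF q(1)]
        by (simp_all add: Q.src_of_obj Q.tgt_of_obj)
      then show "src G (\<iota> ?x) = src G g" "tgt G (\<iota> ?x) = src G g"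
        using p(3) ix g(1) by (auto simp: inj_on_def G.src_obj G.tgt_obj)
    qed
    show ?thesis
      unfolding e using conj[OF g(1) a] x ix g
      by (simp add: iota f_ops G.ginv_closed G.src_ginv G.tgt_ginv composable_H G.comp_closed G.tgt_comp)
  qed
  have "extension Q A H \<iota>' \<phi>'"
    unfolding extension_def
    using ordered_groupoid_H emb phi_functor surj inj ker' pi' conj' by blast
  then show ?thesis
    unfolding equivalent_extensions_def using ext functor_f iota phi by auto
qed

end

section \<open>The quotient by a kernel\<close>

text \<open>The first isomorphism theorem: if \<open>\<Psi>\<close> is surjective and injective on objects, then \<open>S\<close> modulo
  the kernel of \<open>\<Psi>\<close> is \<open>G\<close>.  The image of the order of a groupoid under a surjective functor may be
  strictly smaller than the given order of \<open>G\<close>; \<open>le_lift\<close> excludes this.  Because the elements of \<open>N\<close> are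
  loops, composing classes only ever corestricts an arrow to its full target, and \<open>below_eq_tgt\<close> makes
  that corestriction trivial.\<close>

locale kernel_quotient = S: groupoid S + G: ordered_groupoid G
  for S :: "'s ogpd" and G :: "'g ogpd" +
  fixes \<Psi> :: "'s \<Rightarrow> 'g" and N :: "'s set"
  assumes Psi_ordered_functor: "ordered_functor S G \<Psi>"
    and surj: "\<Psi> ` arr S = arr G"
    and inj_obj: "inj_on \<Psi> (objs S)"
    and N_kernel: "N = {x \<in> arr S. \<Psi> x \<in> objs G}"
    and le_refl: "x \<in> arr S \<Longrightarrow> le S x x"
    and le_lift: "\<lbrakk>g \<in> arr G; y \<in> arr S; le G g (\<Psi> y)\<rbrakk> \<Longrightarrow> \<exists>x \<in> arr S. le S x y \<and> \<Psi> x = g"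
    and below_eq_tgt: "\<lbrakk>x \<in> arr S; y \<in> arr S; le S x y; tgt S x = tgt S y\<rbrakk> \<Longrightarrow> x = y"
begin

definition fibre :: "'g \<Rightarrow> 's set" where
  "fibre g = {x \<in> arr S. \<Psi> x = g}"

lemmas functorD = ordered_functorD[OF Psi_ordered_functor]

lemma src_eq_iff: "\<lbrakk>x \<in> arr S; y \<in> arr S\<rbrakk> \<Longrightarrow> src S x = src S y \<longleftrightarrow> src G (\<Psi> x) = src G (\<Psi> y)"
  and composable_iff: "\<lbrakk>x \<in> arr S; y \<in> arr S\<rbrakk> \<Longrightarrow> tgt S x = src S y \<longleftrightarrow> tgt G (\<Psi> x) = src G (\<Psi> y)"
  using inj_obj S.src_obj S.tgt_obj functorD(2,3) by (metis inj_onD)+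

text \<open>The kernel is a union of groups: an element of \<open>N\<close> lies over an identity, so its ends have the same
  image, and \<open>\<Psi>\<close> separates objects.\<close>

lemma kernelD:
  assumes "a \<in> N"
  shows "a \<in> arr S" "src S a = tgt S a" "\<Psi> a = src G (\<Psi> a)" "\<Psi> a = tgt G (\<Psi> a)"
  using assms composable_iff[of a a]
  by (auto simp: N_kernel G.src_of_obj G.tgt_of_obj)

lemma obj_in_N: "e \<in> objs S \<Longrightarrow> e \<in> N"
  using functor_obj[OF S.groupoid_axioms G.groupoid_axioms Psi_ordered_functor] by (simp add: N_kernel S.obj_arr)

lemma kernel_comp:
  assumes "a \<in> N" "b \<in> N" "x \<in> arr S" "tgt S a = src S x" "tgt S x = src S b"
  shows "comp S (comp S a x) b \<in> arr S" "\<Psi> (comp S (comp S a x) b) = \<Psi> x"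
proof -
  note a = kernelD[OF assms(1)] and b = kernelD[OF assms(2)]
  have e: "\<Psi> a = src G (\<Psi> x)" "\<Psi> b = tgt G (\<Psi> x)"
    using assms a b functorD(2,3) by metis+
  show "comp S (comp S a x) b \<in> arr S"
    using assms a b by (simp add: S.comp_closed S.tgt_comp)
  show "\<Psi> (comp S (comp S a x) b) = \<Psi> x"
    using assms a b functorD(1)[of x]
    by (simp add: functorD(4) S.comp_closed S.tgt_comp e G.src_unit G.tgt_unit)
qed

text \<open>If \<open>\<Psi> y = \<Psi> x\<close>, then \<open>x\<close> and \<open>y\<close> have a common source, and \<open>y = x (x\<^sup>-\<^sup>1 y)\<close> with \<open>x\<^sup>-\<^sup>1 y\<close> in
  the kernel.\<close>

lemma quot_class_eq:
  assumes "x \<in> arr S"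
  shows "quot_class S N x = fibre (\<Psi> x)"
proof
  show "quot_class S N x \<subseteq> fibre (\<Psi> x)"
    using kernel_comp assms by (auto simp: quot_class_def fibre_def)
  show "fibre (\<Psi> x) \<subseteq> quot_class S N x"
  proof
    fix y assume "y \<in> fibre (\<Psi> x)"
    then have y: "y \<in> arr S" "\<Psi> y = \<Psi> x" by (auto simp: fibre_def)
    have s: "src S x = src S y" using src_eq_iff[OF assms y(1)] y(2) by simp
    let ?a = "src S x" and ?b = "comp S (ginv S x) y"
    have b: "?b \<in> arr S"
      using s assms y by (simp add: S.comp_closed S.ginv_closed S.tgt_ginv)
    have "\<Psi> ?b = tgt G (\<Psi> x)"
      using s assms y functor_ginv[OF S.groupoid_axioms G.groupoid_axioms Psi_ordered_functor assms]
      by (simp add: functorD S.ginv_closed S.tgt_ginv G.ginv_comp)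
    then have "?b \<in> N" using b assms functorD(1) by (simp add: N_kernel G.tgt_obj)
    moreover have "?a \<in> N" using obj_in_N S.src_obj assms by simp
    moreover have "tgt S ?a = src S x" using S.tgt_of_obj[OF S.src_obj] assms by simp
    moreover have "tgt S x = src S ?b"
      using s assms y by (simp add: S.src_comp S.ginv_closed S.src_ginv S.tgt_ginv)
    moreover have "y = comp S (comp S ?a x) ?b"
      unfolding S.src_unit[OF assms] S.comp_ginv_comp[OF assms y(1) s] by (rule refl)
    ultimately show "y \<in> quot_class S N x" unfolding quot_class_def by blast
  qed
qed

lemma fibre_nonempty:
  assumes "g \<in> arr G"
  obtains x where "x \<in> arr S" "\<Psi> x = g" "x \<in> fibre g"
proof -
  from assms have "g \<in> \<Psi> ` arr S" by (simp add: surj)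
  then show thesis using that by (auto simp: fibre_def)
qed

lemma UN_fibre:
  assumes "g \<in> arr G" "\<And>x. \<lbrakk>x \<in> arr S; \<Psi> x = g\<rbrakk> \<Longrightarrow> f x = c"
  shows "(\<Union>x \<in> fibre g. f x) = c"
proof (rule UN_const)
  show "fibre g \<noteq> {}" using fibre_nonempty[OF assms(1)] by blast
qed (use assms(2) in \<open>simp add: fibre_def\<close>)

lemma quot_comp_fibre:
  assumes g: "g \<in> arr G" and h: "h \<in> arr G" and c: "tgt G g = src G h"
  shows "comp (quot_ogpd S N) (fibre g) (fibre h) = fibre (comp G g h)"
proof -
  have "comp (quot_ogpd S N) (fibre g) (fibre h) =
      (\<Union>x \<in> fibre g. \<Union>y \<in> fibre h. \<Union>p \<in> {p \<in> N. le S (src S p) (tgt S x) \<and> tgt S p = src S y}.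
        quot_class S N (comp S (comp S (corst S x (src S p)) p) y))"
    by (simp add: quot_ogpd_def)
  also have "\<dots> = fibre (comp G g h)"
  proof (intro UN_fibre UN_const g h)
    fix x y assume x: "x \<in> arr S" "\<Psi> x = g" and y: "y \<in> arr S" "\<Psi> y = h"
    have xy: "tgt S x = src S y" using composable_iff x y c by simp
    have "tgt S x \<in> {p \<in> N. le S (src S p) (tgt S x) \<and> tgt S p = src S y}"
      using S.tgt_obj[OF x(1)] obj_in_N le_refl xy
      by (simp add: S.src_of_obj S.tgt_of_obj S.obj_arr)
    then show "{p \<in> N. le S (src S p) (tgt S x) \<and> tgt S p = src S y} \<noteq> {}" by blast
    fix p assume "p \<in> {p \<in> N. le S (src S p) (tgt S x) \<and> tgt S p = src S y}"
    then have p: "p \<in> N" "tgt S p = src S y" by auto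
    note pD = kernelD[OF p(1)]
    have src: "src S p = tgt S x" using pD(2) p(2) xy by simp
    have "corst S x (src S p) = x"
      unfolding corst_def src
      by (rule the_equality) (use x le_refl below_eq_tgt in auto)
    moreover have "comp S (comp S x p) y \<in> arr S"
      using x y p pD src by (simp add: S.comp_closed S.tgt_comp)
    moreover have "\<Psi> (comp S (comp S x p) y) = comp G g h"
    proof -
      have "\<Psi> p = tgt G g" using pD(3) functorD(2)[of p] functorD(3)[of x] src pD(1) x by metis
      then show ?thesis
        using x y p pD src functorD(1)[OF x(1)] G.tgt_unit[OF g]
        by (simp add: functorD(4) S.comp_closed S.tgt_comp)
    qed
    ultimately show "quot_class S N (comp S (comp S (corst S x (src S p)) p) y) = fibre (comp G g h)"
      by (simp add: quot_class_eq)
  qed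
  finally show ?thesis .
qed

lemma quot_le_fibre:
  assumes g: "g \<in> arr G" and h: "h \<in> arr G"
  shows "le (quot_ogpd S N) (fibre g) (fibre h) \<longleftrightarrow> le G g h"
proof
  assume "le (quot_ogpd S N) (fibre g) (fibre h)"
  then obtain x y a b where xy: "x \<in> arr S" "\<Psi> x = g" "y \<in> arr S" "\<Psi> y = h" "a \<in> N" "b \<in> N"
    "tgt S a = src S x" "tgt S x = src S b" "le S (comp S (comp S a x) b) y"
    by (auto simp: quot_ogpd_def fibre_def)
  then show "le G g h"
    using functorD(5)[of "comp S (comp S a x) b" y] kernel_comp[of a b x] by simp
next
  assume gh: "le G g h"
  obtain y where y: "y \<in> arr S" "\<Psi> y = h" "y \<in> fibre h" using fibre_nonempty[OF h] .
  obtain x where x: "x \<in> arr S" "le S x y" "\<Psi> x = g" using le_lift g gh y by blast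
  have "comp S (comp S (src S x) x) (tgt S x) = x"
    using x by (simp add: S.src_unit S.tgt_unit)
  moreover have "tgt S (src S x) = src S x" "tgt S x = src S (tgt S x)"
    using S.tgt_of_obj[OF S.src_obj] S.src_of_obj[OF S.tgt_obj] x by auto
  moreover have "src S x \<in> N" "tgt S x \<in> N" "x \<in> fibre g"
    using obj_in_N S.src_obj S.tgt_obj x by (auto simp: fibre_def)
  ultimately show "le (quot_ogpd S N) (fibre g) (fibre h)"
    using x y unfolding quot_ogpd_def by simp metis
qed

lemma fibre_iso: "ogpd_iso G (quot_ogpd S N) fibre"
  unfolding ogpd_iso_def bij_betw_def
proof (intro conjI ballI impI)
  show "inj_on fibre (arr G)"
    by (rule inj_onI) (metis (mono_tags, lifting) fibre_def fibre_nonempty mem_Collect_eq)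
  have "arr (quot_ogpd S N) = quot_class S N ` arr S" by (simp add: quot_ogpd_def)
  also have "\<dots> = fibre ` \<Psi> ` arr S" by (simp add: image_image quot_class_eq)
  finally show "fibre ` arr G = arr (quot_ogpd S N)" using surj by simp
next
  fix g assume g: "g \<in> arr G"
  have "src (quot_ogpd S N) (fibre g) = (\<Union>x \<in> fibre g. quot_class S N (src S x))"
    by (simp add: quot_ogpd_def)
  also have "\<dots> = fibre (src G g)"
    by (rule UN_fibre[OF g]) (auto simp: quot_class_eq S.obj_arr S.src_obj functorD(2))
  finally show "src (quot_ogpd S N) (fibre g) = fibre (src G g)" .
  have "tgt (quot_ogpd S N) (fibre g) = (\<Union>x \<in> fibre g. quot_class S N (tgt S x))"
    by (simp add: quot_ogpd_def)
  also have "\<dots> = fibre (tgt G g)"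
    by (rule UN_fibre[OF g]) (auto simp: quot_class_eq S.obj_arr S.tgt_obj functorD(3))
  finally show "tgt (quot_ogpd S N) (fibre g) = fibre (tgt G g)" .
  have "ginv (quot_ogpd S N) (fibre g) = (\<Union>x \<in> fibre g. quot_class S N (ginv S x))"
    by (simp add: quot_ogpd_def)
  also have "\<dots> = fibre (ginv G g)"
    by (rule UN_fibre[OF g])
       (auto simp: quot_class_eq S.ginv_closed
         functor_ginv[OF S.groupoid_axioms G.groupoid_axioms Psi_ordered_functor])
  finally show "ginv (quot_ogpd S N) (fibre g) = fibre (ginv G g)" .
qed (simp_all add: quot_comp_fibre quot_le_fibre)

end

section \<open>Lifting the free groupoid into an extension\<close>

context ogpd_paths
begin

text \<open>In \<open>free_ogpd Q\<close> and in \<open>Q\<close> the objects correspond, so the ends of a class of words can be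
  read off in \<open>Q\<close>.\<close>

lemma free_src_pi: "X \<in> arr F \<Longrightarrow> src F X = free_id Q (src Q (free_pi Q X))"
  and free_tgt_pi: "X \<in> arr F \<Longrightarrow> tgt F X = free_id Q (tgt Q (free_pi Q X))"
proof -
  assume X: "X \<in> arr F"
  interpret F: groupoid F by (rule free_groupoid)
  obtain v w where vw: "src F X = free_id Q v" "tgt F X = free_id Q w"
    using F.src_obj[OF X] F.tgt_obj[OF X] unfolding objs_free by auto
  note D = ordered_functorD(2,3)[OF free_pi_functor, OF X]
  show "src F X = free_id Q (src Q (free_pi Q X))" "tgt F X = free_id Q (tgt Q (free_pi Q X))"
    using vw D by (simp_all add: free_pi_id flip: D)
qed

lemma free_id_arr: "e \<in> objs Q \<Longrightarrow> free_id Q e \<in> arr F"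
  by (simp add: free_id_def free_arrI)

end

locale module_extension = ogpd_paths Q + ogpd_module Q A + G: ordered_groupoid G
  for Q :: "'q ogpd" (structure) and A :: "('q, 'm) gmodule" and G :: "'g ogpd" +
  fixes \<iota> :: "'q \<times> 'm \<Rightarrow> 'g" and \<phi> :: "'g \<Rightarrow> 'q"
  assumes ext: "extension Q A G \<iota> \<phi>"
begin

abbreviation "M \<equiv> mod_ogpd Q A"

lemmas iota_functor = extensionD(1)[OF ext]
lemmas iota_inj = extensionD(2)[OF ext]
lemmas iota_reflects_le = extensionD(3)[OF ext]
lemmas phi_functor = extensionD(4)[OF ext]
lemmas phi_surj = extensionD(5)[OF ext]
lemmas phi_inj_obj = extensionD(6)[OF ext]
lemmas iota_image = extensionD(7)[OF ext]
lemmas phi_iota = extensionD(8)[OF ext, simplified]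
lemmas iota_conj = extensionD(9)[OF ext]
lemmas iotaD = ordered_functorD[OF iota_functor]
lemmas phiD = ordered_functorD[OF phi_functor]

lemma fib: "e \<in> objs Q \<Longrightarrow> group (fib A e)" "e \<in> objs Q \<Longrightarrow> monoid (fib A e)"
  "e \<in> objs Q \<Longrightarrow> \<one>\<^bsub>fib A e\<^esub> \<in> carrier (fib A e)"
  using fib_group comm_group.axioms(2) group.is_monoid monoid.one_closed by blast+

text \<open>The objects of \<open>Q\<close> and those of \<open>G\<close> correspond as posets: \<open>\<phi>\<close> is injective and monotone on
  objects, and \<open>unit\<close> is a monotone inverse because \<open>\<iota>\<close> is an ordered functor.\<close>

definition unit :: "'q \<Rightarrow> 'g" where
  "unit e = \<iota> (e, \<one>\<^bsub>fib A e\<^esub>)"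

lemma phi_obj: "x \<in> objs G \<Longrightarrow> \<phi> x \<in> objs Q"
  using functor_obj[OF G.groupoid_axioms groupoid_axioms phi_functor] .

lemma unit_obj: "e \<in> objs Q \<Longrightarrow> unit e \<in> objs G"
  using functor_obj[OF mod_groupoid G.groupoid_axioms iota_functor, of "(e, \<one>\<^bsub>fib A e\<^esub>)"]
  by (simp add: unit_def objs_mod)

lemma phi_unit: "e \<in> objs Q \<Longrightarrow> \<phi> (unit e) = e"
  by (simp add: unit_def phi_iota fib)

lemma unit_phi: "x \<in> objs G \<Longrightarrow> unit (\<phi> x) = x"
  using phi_inj_obj unit_obj[OF phi_obj] phi_unit[OF phi_obj] by (auto dest: inj_onD)

lemma src_unit_phi: "g \<in> arr G \<Longrightarrow> src G g = unit (src Q (\<phi> g))"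
  and tgt_unit_phi: "g \<in> arr G \<Longrightarrow> tgt G g = unit (tgt Q (\<phi> g))"
  using unit_phi[OF G.src_obj] unit_phi[OF G.tgt_obj] phiD(2,3) by metis+

lemma unit_mono:
  assumes "e \<in> objs Q" "f \<in> objs Q" "e \<sqsubseteq> f"
  shows "le G (unit e) (unit f)"
  unfolding unit_def
  using hom_one[OF act_restriction_hom[OF assms(2,1,3)]] assms
  by (intro iotaD(5)) (simp_all add: fib)

lemma iota_arr: "\<lbrakk>e \<in> objs Q; a \<in> carrier (fib A e)\<rbrakk> \<Longrightarrow> \<iota> (e, a) \<in> arr G"
  by (simp add: iotaD(1))

lemma iota_ends:
  assumes "e \<in> objs Q" "a \<in> carrier (fib A e)"
  shows "src G (\<iota> (e, a)) = unit e" "tgt G (\<iota> (e, a)) = unit e"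
  using assms by (simp_all add: src_unit_phi tgt_unit_phi iota_arr phi_iota src_of_obj tgt_of_obj)

lemma iota_mult:
  assumes "e \<in> objs Q" "a \<in> carrier (fib A e)" "b \<in> carrier (fib A e)"
  shows "comp G (\<iota> (e, a)) (\<iota> (e, b)) = \<iota> (e, a \<otimes>\<^bsub>fib A e\<^esub> b)"
  using iotaD(4)[of "(e, a)" "(e, b)"] assms by simp

lemma iota_eq_iff:
  "\<lbrakk>e \<in> objs Q; a \<in> carrier (fib A e); f \<in> objs Q; b \<in> carrier (fib A f)\<rbrakk>
    \<Longrightarrow> \<iota> (e, a) = \<iota> (f, b) \<longleftrightarrow> e = f \<and> a = b"
  using inj_on_eq_iff[OF iota_inj] by simp

lemma over_objectE:
  assumes "g \<in> arr G" "\<phi> g \<in> objs Q"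
  obtains a where "a \<in> carrier (fib A (\<phi> g))" "g = \<iota> (\<phi> g, a)"
proof -
  have "g \<in> \<iota> ` arr M" using assms by (simp add: iota_image)
  then obtain e a where a: "e \<in> objs Q" "a \<in> carrier (fib A e)" "g = \<iota> (e, a)" by auto
  then have "\<phi> g = e" using phi_iota by simp
  then show thesis using a that by blast
qed

text \<open>The conjugation condition of an extension, in the form used to move a fibre element past an arrow.\<close>

lemma iota_commute:
  assumes g: "g \<in> arr G" and a: "a \<in> carrier (fib A (src Q (\<phi> g)))"
  shows "comp G (\<iota> (src Q (\<phi> g), a)) g = comp G g (\<iota> (tgt Q (\<phi> g), lact Q A a (\<phi> g)))"
proof -
  let ?x = "\<iota> (src Q (\<phi> g), a)"
  have q: "\<phi> g \<in> arr Q" "src Q (\<phi> g) \<in> objs Q" using g phiD(1) src_obj by auto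
  have x: "?x \<in> arr G" "src G ?x = src G g" "tgt G ?x = src G g"
    using iota_arr[OF q(2) a] iota_ends[OF q(2) a] src_unit_phi[OF g] by auto
  have "comp G (comp G (ginv G g) ?x) g = \<iota> (tgt Q (\<phi> g), lact Q A a (\<phi> g))"
    using iota_conj[of g a] g a phiD(2,3) by simp
  then have "comp G g (\<iota> (tgt Q (\<phi> g), lact Q A a (\<phi> g))) = comp G g (comp G (ginv G g) (comp G ?x g))"
    using g x by (simp add: G.comp_assoc G.ginv_closed G.tgt_ginv)
  also have "\<dots> = comp G ?x g"
    using g x by (intro G.comp_ginv_comp) (simp_all add: G.comp_closed G.src_comp)
  finally show ?thesis by simp
qed

definition chosen_lift :: "'q \<Rightarrow> 'g" where
  "chosen_lift q = (SOME g. g \<in> arr G \<and> \<phi> g = q)"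

lemma chosen_lift: "q \<in> arr Q \<Longrightarrow> chosen_lift q \<in> arr G \<and> \<phi> (chosen_lift q) = q"
proof -
  assume "q \<in> arr Q"
  then have "q \<in> \<phi> ` arr G" by (simp add: phi_surj)
  then have "\<exists>g. g \<in> arr G \<and> \<phi> g = q" by auto
  then show "chosen_lift q \<in> arr G \<and> \<phi> (chosen_lift q) = q" unfolding chosen_lift_def by (rule someI_ex)
qed

fun lift_letter :: "'q letter \<Rightarrow> 'g" where
  "lift_letter (Fwd e q) = rst G (unit e) (chosen_lift q)"
| "lift_letter (Bwd e q) = ginv G (rst G (unit e) (chosen_lift q))"

text \<open>A set-theoretic section \<open>q \<mapsto> chosen_lift q\<close> of \<open>\<phi>\<close> need not be monotone, so the edge \<open>(e|\<lfloor>q\<rfloor>)\<close> is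
  sent to a restriction of the chosen lift of \<open>q\<close> itself, not to the chosen lift of \<open>(e|q)\<close>.  This
  still lies over \<open>(e|q)\<close>, because \<open>\<phi>\<close> preserves restrictions.\<close>

lemma lift_restriction:
  assumes "q \<in> arr Q" "e \<in> objs Q" "e \<sqsubseteq> src Q q"
  shows "le G (unit e) (src G (chosen_lift q))" "rst G (unit e) (chosen_lift q) \<in> arr G"
    "src G (rst G (unit e) (chosen_lift q)) = unit e" "\<phi> (rst G (unit e) (chosen_lift q)) = rst Q e q"
proof -
  let ?r = "rst G (unit e) (chosen_lift q)"
  show le: "le G (unit e) (src G (chosen_lift q))"
    using unit_mono[OF assms(2) src_obj[OF assms(1)] assms(3)] chosen_lift[OF assms(1)] src_unit_phi by simp
  note r = G.rst[OF conjunct1[OF chosen_lift[OF assms(1)]] unit_obj[OF assms(2)] le]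
  then show "?r \<in> arr G" "src G ?r = unit e" by auto
  have "\<phi> ?r \<sqsubseteq> q" using phiD(5)[OF r(1) _ r(2)] chosen_lift[OF assms(1)] by simp
  moreover have "src Q (\<phi> ?r) = e" using phiD(2)[OF r(1)] r(3) phi_unit[OF assms(2)] by simp
  ultimately show "\<phi> ?r = rst Q e q"
    using rst_eqI[OF assms(1) phiD(1)[OF r(1)]] by simp
qed

sublocale lift: letter_assignment Q G unit lift_letter
proof
  fix l assume l: "letter_ok Q l"
  show "lift_letter l \<in> arr G"
    using l by (cases l) (auto simp: lift_restriction G.ginv_closed)
  show "lift_letter (letter_inv l) = ginv G (lift_letter l)"
    using l by (cases l) (auto simp: lift_restriction G.ginv_ginv)
  show "src G (lift_letter l) = unit (letter_src Q l)"
    using l by (cases l) (auto simp: lift_restriction G.src_ginv tgt_unit_phi)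
next
  fix l' l assume l: "letter_ok Q l'" "letter_ok Q l" "letter_le Q l' l"
  have "le G (rst G (unit e') (chosen_lift q)) (rst G (unit e) (chosen_lift q))"
    if "q \<in> arr Q" "e \<in> objs Q" "e' \<in> objs Q" "e' \<sqsubseteq> e" "e \<sqsubseteq> src Q q" for e e' q
    using G.rst_mono[of "chosen_lift q" "unit e'" "unit e"] that chosen_lift[of q] unit_obj unit_mono
      lift_restriction(1)[of q e] by simp
  then show "le G (lift_letter l') (lift_letter l)"
    using l by (cases l; cases l') (auto simp: lift_restriction(2) intro!: G.OG1)
qed (simp_all add: unit_obj unit_mono)

abbreviation \<psi> :: "'q path set \<Rightarrow> 'g" where
  "\<psi> \<equiv> lift.free_ext"

lemmas psiD = ordered_functorD[OF lift.free_ext_functor]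
lemmas piD = ordered_functorD[OF free_pi_functor]

lemma phi_psi:
  assumes "X \<in> arr F"
  shows "\<phi> (\<psi> X) = free_pi Q X"
proof -
  have letter: "\<phi> (lift_letter l) = letter_val Q l" if "letter_ok Q l" for l
    using that functor_ginv[OF G.groupoid_axioms groupoid_axioms phi_functor]
    by (cases l) (auto simp: lift_restriction)
  have "\<phi> (lift.word_val v ls) = pi.word_val v ls" if "is_path Q (v, ls)" for v ls
    using that
  proof (induction ls arbitrary: v)
    case (Cons l ls)
    then have p: "letter_ok Q l" "is_path Q (letter_tgt Q l, ls)" by auto
    show ?case
      using Cons.IH[OF p(2)] letter[OF p(1)] lift.m_arr[OF p(1)] lift.tgt_m[OF p(1)]
        lift.word_val[OF p(2)] by (simp add: phiD(4))
  qed (simp add: phi_unit)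
  moreover obtain u where "is_path Q u" "X = path_class Q u" using assms by (rule free_arrE)
  ultimately show ?thesis by (simp add: lift.free_ext_class free_pi_eq pi.free_ext_class)
qed

lemma psi_ends:
  assumes "X \<in> arr F"
  shows "src G (\<psi> X) = unit (src Q (free_pi Q X))" "tgt G (\<psi> X) = unit (tgt Q (free_pi Q X))"
  using src_unit_phi tgt_unit_phi psiD(1)[OF assms] phi_psi[OF assms] by auto

section \<open>The equivariant functor on the kernel\<close>

text \<open>On the kernel of \<open>free_pi\<close> the lift \<open>\<psi>\<close> takes values over identities, that is, in the image of
  the module.  The functor \<open>\<alpha>\<close> is the inverse of this value, and not the value itself: the quotient
  identifies \<open>(w, w\<alpha>)\<close> with an identity, so the image \<open>\<psi> w \<cdot> \<iota> (w\<alpha>)\<close> of this pair has to be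
  an identity.\<close>

definition coord :: "'q path set \<Rightarrow> 'm" where
  "coord X = snd (inv_into (arr M) \<iota> (\<psi> X))"

definition \<alpha> :: "'q path set \<Rightarrow> 'q \<times> 'm" where
  "\<alpha> X = (free_pi Q X, inv\<^bsub>fib A (free_pi Q X)\<^esub> coord X)"

lemma kernelI: "\<lbrakk>X \<in> arr F; free_pi Q X \<in> objs Q\<rbrakk> \<Longrightarrow> X \<in> kernel Q"
  and kernel_arr: "X \<in> kernel Q \<Longrightarrow> X \<in> arr F"
  and kernel_obj: "X \<in> kernel Q \<Longrightarrow> free_pi Q X \<in> objs Q"
  by (simp_all add: kernel_def)

lemma coord_eqI:
  assumes "e \<in> objs Q" "a \<in> carrier (fib A e)" "\<psi> X = \<iota> (e, a)"
  shows "coord X = a"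
  using inv_into_f_f[OF iota_inj, of "(e, a)"] assms by (simp add: coord_def)

lemma coord:
  assumes "X \<in> kernel Q"
  shows "coord X \<in> carrier (fib A (free_pi Q X))" "\<psi> X = \<iota> (free_pi Q X, coord X)"
proof -
  note X = kernel_arr[OF assms] kernel_obj[OF assms]
  obtain a where a: "a \<in> carrier (fib A (free_pi Q X))" "\<psi> X = \<iota> (free_pi Q X, a)"
    using over_objectE[of "\<psi> X"] psiD(1) phi_psi X by metis
  then have "coord X = a" using coord_eqI X by simp
  then show "coord X \<in> carrier (fib A (free_pi Q X))" "\<psi> X = \<iota> (free_pi Q X, coord X)"
    using a by auto
qed

lemma alpha_eqI:
  assumes "X \<in> kernel Q" "e \<in> objs Q" "a \<in> carrier (fib A e)" "\<psi> X = \<iota> (e, a)"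
  shows "\<alpha> X = (e, inv\<^bsub>fib A e\<^esub> a)"
proof -
  have "free_pi Q X = e" using phi_psi[OF kernel_arr[OF assms(1)]] assms phi_iota by simp
  then show ?thesis using coord_eqI[OF assms(2-4)] by (simp add: \<alpha>_def)
qed

lemma alpha_id:
  assumes "e \<in> objs Q"
  shows "free_id Q e \<in> kernel Q" "\<alpha> (free_id Q e) = (e, \<one>\<^bsub>fib A e\<^esub>)"
proof -
  show k: "free_id Q e \<in> kernel Q" using assms by (simp add: kernelI free_id_arr free_pi_id)
  have "\<psi> (free_id Q e) = \<iota> (e, \<one>\<^bsub>fib A e\<^esub>)" by (simp add: lift.free_ext_id unit_def)
  then show "\<alpha> (free_id Q e) = (e, \<one>\<^bsub>fib A e\<^esub>)"
    using alpha_eqI[OF k assms fib(3)[OF assms]] monoid.inv_one[OF fib(2)[OF assms]] by simp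
qed

lemma inv_hom:
  assumes "h \<in> hom (fib A e) (fib A f)" "e \<in> objs Q" "f \<in> objs Q" "a \<in> carrier (fib A e)"
  shows "h (inv\<^bsub>fib A e\<^esub> a) = inv\<^bsub>fib A f\<^esub> h a"
  using group_hom.hom_inv[of "fib A e" "fib A f" h a] assms fib
  by (simp add: group_hom_def group_hom_axioms_def)

text \<open>Inversion is a homomorphism of abelian groups and commutes with the action, so \<open>\<alpha>\<close> inherits
  functoriality and monotonicity from \<open>\<psi>\<close>; the order is reflected because \<open>\<iota>\<close> is an embedding.\<close>

lemma alpha_functor: "ordered_functor (kernel_ogpd Q) M \<alpha>"
proof -
  have ops: "arr (kernel_ogpd Q) = kernel Q" "src (kernel_ogpd Q) = src F"
    "tgt (kernel_ogpd Q) = tgt F" "comp (kernel_ogpd Q) = comp F" "le (kernel_ogpd Q) = le F"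
    by (simp_all add: kernel_ogpd_def)
  have ends: "src F X = free_id Q (free_pi Q X)" "tgt F X = free_id Q (free_pi Q X)"
    if "X \<in> kernel Q" for X
    using free_src_pi free_tgt_pi kernel_arr[OF that] kernel_obj[OF that]
    by (simp_all add: src_of_obj tgt_of_obj)
  show ?thesis
    unfolding ordered_functor_def ops
  proof (intro conjI ballI impI)
    fix X assume X: "X \<in> kernel Q"
    show "\<alpha> X \<in> arr M" "\<alpha> (src F X) = src M (\<alpha> X)" "\<alpha> (tgt F X) = tgt M (\<alpha> X)"
      using X by (simp_all add: ends alpha_id kernel_obj)
        (simp_all add: \<alpha>_def kernel_obj group.inv_closed fib coord)
  next
    fix X Y assume X: "X \<in> kernel Q" and Y: "Y \<in> kernel Q"
    let ?e = "free_pi Q X" and ?f = "free_pi Q Y"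
    note x = kernel_arr[OF X] kernel_obj[OF X] coord[OF X]
      and y = kernel_arr[OF Y] kernel_obj[OF Y] coord[OF Y]
    show "\<alpha> (comp F X Y) = comp M (\<alpha> X) (\<alpha> Y)" if c: "tgt F X = src F Y"
    proof -
      interpret F: groupoid F by (rule free_groupoid)
      have ef: "?f = ?e" using c ends X Y free_pi_id by metis
      then have "free_pi Q (comp F X Y) = ?e"
        using piD(4) x(1) y(1) c obj_comp_obj[OF x(2)] by simp
      then have "comp F X Y \<in> kernel Q"
        using x(1,2) y(1) c by (simp add: kernelI F.comp_closed)
      moreover have "\<psi> (comp F X Y) = \<iota> (?e, coord X \<otimes>\<^bsub>fib A ?e\<^esub> coord Y)"
        using psiD(4)[OF x(1) y(1) c] x y ef iota_mult by simp
      ultimately show ?thesis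
        using x y ef fib[OF x(2)] alpha_eqI[of "comp F X Y" ?e "coord X \<otimes>\<^bsub>fib A ?e\<^esub> coord Y"]
          comm_group.inv_mult[OF fib_group[OF x(2)]]
        by (simp add: monoid.m_closed) (simp add: \<alpha>_def ef)
    qed
    show "le M (\<alpha> X) (\<alpha> Y)" if "le F X Y"
    proof -
      have "le M (?e, coord X) (?f, coord Y)"
        using psiD(5)[OF x(1) y(1) that] x y by (intro iota_reflects_le) simp_all
      then have le: "?e \<sqsubseteq> ?f" "coord X = act A (coord Y) (?f, ?e)" by simp_all
      then show ?thesis
        using inv_hom[OF act_restriction_hom[OF y(2) x(2) le(1)] y(2) x(2) y(3)] x(2)
        by (simp add: \<alpha>_def)
    qed
  qed
qed

text \<open>Since \<open>\<psi>\<close> is a functor, conjugation by \<open>H\<close> becomes conjugation by \<open>\<psi> H\<close> in \<open>G\<close>, which acts on the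
  fibres by the module action.\<close>

lemma alpha_equivariant:
  assumes H: "H \<in> arr F" and X: "X \<in> kernel Q" and s: "src F X = src F H"
  shows "\<alpha> (comp F (comp F (ginv F H) X) H) =
    (tgt Q (free_pi Q H), lact Q A (snd (\<alpha> X)) (free_pi Q H))"
proof -
  interpret F: groupoid F by (rule free_groupoid)
  note x = kernel_arr[OF X] kernel_obj[OF X] coord[OF X]
  let ?e = "free_pi Q X" and ?h = "free_pi Q H"
  have h: "?h \<in> arr Q" "tgt Q ?h \<in> objs Q" using piD(1)[OF H] tgt_obj by auto
  have e: "src Q ?h = ?e" "tgt F X = src F H"
  proof -
    show "src Q ?h = ?e"
      using s piD(2)[OF H] piD(2)[OF x(1)] x(2) by (simp add: src_of_obj)
    then show "tgt F X = src F H"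
      using free_tgt_pi[OF x(1)] free_src_pi[OF H] x(2) by (simp add: tgt_of_obj)
  qed
  let ?Z = "comp F (comp F (ginv F H) X) H"
  note cl = F.ginv_closed[OF H] F.tgt_ginv[OF H] F.comp_closed F.tgt_comp
  have Z: "?Z \<in> arr F" "tgt F ?Z = tgt F H" using H x s e by (simp_all add: cl)
  have psi_inv: "\<psi> (ginv F H) = ginv G (\<psi> H)"
    using functor_ginv[OF F.groupoid_axioms G.groupoid_axioms lift.free_ext_functor H] .
  have "\<psi> ?Z = comp G (comp G (ginv G (\<psi> H)) (\<iota> (?e, coord X))) (\<psi> H)"
    using H x s e psi_inv by (simp add: psiD(4) cl)
  also have "\<dots> = \<iota> (tgt Q ?h, lact Q A (coord X) ?h)"
    using iota_conj[OF psiD(1)[OF H], of "coord X"] x(3) psiD(1)[OF H] phi_psi[OF H] e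
    by (simp add: phiD(2,3))
  finally have psi: "\<psi> ?Z = \<iota> (tgt Q ?h, lact Q A (coord X) ?h)" .
  have hom: "(\<lambda>a. lact Q A a ?h) \<in> hom (fib A ?e) (fib A (tgt Q ?h))"
    using lact_hom[OF h(1)] e by simp
  have c: "lact Q A (coord X) ?h \<in> carrier (fib A (tgt Q ?h))"
    using hom_in_carrier[OF hom x(3)] .
  have "free_pi Q ?Z = tgt Q ?h" using phi_psi[OF Z(1)] psi phi_iota h c by simp
  then have "?Z \<in> kernel Q" using Z h by (simp add: kernelI)
  then have "\<alpha> ?Z = (tgt Q ?h, inv\<^bsub>fib A (tgt Q ?h)\<^esub> lact Q A (coord X) ?h)"
    using alpha_eqI[OF _ h(2) c psi] by simp
  also have "\<dots> = (tgt Q ?h, lact Q A (snd (\<alpha> X)) ?h)"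
    using inv_hom[OF hom x(2) h(2) x(3)] by (simp add: \<alpha>_def)
  finally show ?thesis .
qed

lemma alpha_kernel_hom: "\<alpha> \<in> kernel_homs Q A"
  using alpha_functor alpha_id(2) alpha_equivariant by (simp add: kernel_homs_def)

section \<open>The extension as a quotient of the semidirect product\<close>

abbreviation "S \<equiv> free_semidirect Q A"

text \<open>A class of words acts through its value in \<open>Q\<close>, so the laws of the action are inherited from \<open>A\<close>.\<close>

lemma lact_pullback:
  "X \<in> arr F \<Longrightarrow> lact F (pullback_mod (free_pi Q) A) a X = lact Q A a (free_pi Q X)"
  using piD(2) by (simp add: lact_def pullback_mod_def)

lemma S_groupoid: "groupoid S"
proof -
  interpret F: groupoid F by (rule free_groupoid)
  let ?P = "pullback_mod (free_pi Q) A"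
  have fibre: "fib ?P E = fib A (free_pi Q E)" for E
    by (simp add: pullback_mod_def)
  have obj: "free_pi Q E \<in> objs Q" if "E \<in> objs F" for E
    using functor_obj[OF F.groupoid_axioms groupoid_axioms free_pi_functor that] .
  show ?thesis
    unfolding free_semidirect_def
  proof (rule semidirect_groupoid[OF free_groupoid])
    fix E assume E: "E \<in> objs F"
    then show "group (fib ?P E)"
      using fib(1) obj by (simp add: fibre)
    fix a assume "a \<in> carrier (fib ?P E)"
    then show "lact F ?P a E = a"
      using E obj by (simp add: lact_pullback F.obj_arr lact_obj fibre)
  next
    fix X assume X: "X \<in> arr F"
    then show "(\<lambda>a. lact F ?P a X) \<in> hom (fib ?P (src F X)) (fib ?P (tgt F X))"
      using lact_hom[OF piD(1)[OF X]] by (simp add: lact_pullback piD fibre)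
    fix Y a assume Y: "Y \<in> arr F" "tgt F X = src F Y" and a: "a \<in> carrier (fib ?P (src F X))"
    have "tgt Q (free_pi Q X) = src Q (free_pi Q Y)"
      using Y(2) piD(3)[OF X] piD(2)[OF Y(1)] by simp
    then show "lact F ?P a (comp F X Y) = lact F ?P (lact F ?P a X) Y"
      using X Y a lact_comp[of "free_pi Q X" "free_pi Q Y" a]
      by (simp add: lact_pullback F.comp_closed piD fibre)
  qed
qed

sublocale S: groupoid S by (rule S_groupoid)

lemma S_arr: "(X, a) \<in> arr S \<longleftrightarrow> X \<in> arr F \<and> a \<in> carrier (fib A (tgt Q (free_pi Q X)))"
  by (auto simp: free_semidirect_def semidirect_def pullback_mod_def piD)

lemma S_src: "X \<in> arr F \<Longrightarrow> src S (X, a) = (src F X, \<one>\<^bsub>fib A (src Q (free_pi Q X))\<^esub>)"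
  and S_tgt: "X \<in> arr F \<Longrightarrow> tgt S (X, a) = (tgt F X, \<one>\<^bsub>fib A (tgt Q (free_pi Q X))\<^esub>)"
  by (simp_all add: free_semidirect_def semidirect_def pullback_mod_def piD)

lemma S_comp: "Y \<in> arr F \<Longrightarrow> comp S (X, a) (Y, b) =
    (comp F X Y, lact Q A a (free_pi Q Y) \<otimes>\<^bsub>fib A (tgt Q (free_pi Q Y))\<^esub> b)"
  using lact_pullback by (simp add: free_semidirect_def semidirect_def) (simp add: pullback_mod_def piD)

lemma S_le: "\<lbrakk>X \<in> arr F; Y \<in> arr F\<rbrakk> \<Longrightarrow> le S (X, a) (Y, b) \<longleftrightarrow> le F X Y \<and> le F (tgt F X) (tgt F Y) \<and>
    a = act A b (tgt Q (free_pi Q Y), tgt Q (free_pi Q X))"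
  using groupoid.tgt_obj[OF free_groupoid]
  by (auto simp: free_semidirect_def semidirect_def pullback_mod_def piD mod_ogpd_def)

text \<open>This is the canonical map onto \<open>G\<close>: words act through \<open>\<psi>\<close> and module elements through \<open>\<iota>\<close>.\<close>

fun \<Psi> :: "'q path set \<times> 'm \<Rightarrow> 'g" where
  "\<Psi> (X, a) = comp G (\<psi> X) (\<iota> (tgt Q (free_pi Q X), a))"

lemma Psi:
  assumes "X \<in> arr F" "a \<in> carrier (fib A (tgt Q (free_pi Q X)))"
  shows Psi_arr: "\<Psi> (X, a) \<in> arr G"
    and phi_Psi: "\<phi> (\<Psi> (X, a)) = free_pi Q X"
    and Psi_src: "src G (\<Psi> (X, a)) = unit (src Q (free_pi Q X))"
    and Psi_tgt: "tgt G (\<Psi> (X, a)) = unit (tgt Q (free_pi Q X))"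
proof -
  have p: "free_pi Q X \<in> arr Q" "tgt Q (free_pi Q X) \<in> objs Q"
    using piD(1)[OF assms(1)] tgt_obj by auto
  note i = iota_arr[OF p(2) assms(2)] iota_ends[OF p(2) assms(2)] phi_iota[OF conjI[OF p(2) assms(2)]]
    and x = psiD(1)[OF assms(1)] psi_ends[OF assms(1)] phi_psi[OF assms(1)]
  show "\<Psi> (X, a) \<in> arr G" using i x by (simp add: G.comp_closed)
  show "\<phi> (\<Psi> (X, a)) = free_pi Q X"
    using i x tgt_unit[OF p(1)] by (simp add: phiD(4))
  show "src G (\<Psi> (X, a)) = unit (src Q (free_pi Q X))" "tgt G (\<Psi> (X, a)) = unit (tgt Q (free_pi Q X))"
    using i x by (simp_all add: G.src_comp G.tgt_comp)
qed

lemma Psi_id: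
  assumes "e \<in> objs Q" "a \<in> carrier (fib A e)"
  shows "\<Psi> (free_id Q e, a) = \<iota> (e, a)"
  using G.src_unit[OF iota_arr[OF assms]] iota_ends[OF assms] assms(1)
  by (simp add: lift.free_ext_id free_pi_id tgt_of_obj)

text \<open>Functoriality is the conjugation condition: the product
  \<open>\<psi> X \<cdot> \<iota> a \<cdot> \<psi> Y \<cdot> \<iota> b\<close> is brought to the form \<open>\<psi> X \<cdot> \<psi> Y \<cdot> \<iota> (a \<lhd> Y) \<cdot> \<iota> b\<close>.\<close>

lemma Psi_functor: "ordered_functor S G \<Psi>"
proof -
  have id: "\<Psi> (free_id Q e, \<one>\<^bsub>fib A e\<^esub>) = unit e" if "e \<in> objs Q" for e
    using Psi_id[OF that] fib[OF that] by (simp add: unit_def)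
  show ?thesis
    unfolding ordered_functor_def
  proof (intro conjI ballI impI)
    fix x assume "x \<in> arr S"
    then obtain X a where x: "x = (X, a)" "X \<in> arr F" "a \<in> carrier (fib A (tgt Q (free_pi Q X)))"
      by (cases x) (auto simp: S_arr)
    note p = piD(1)[OF x(2)]
    show "\<Psi> x \<in> arr G" using Psi_arr x by simp
    show "\<Psi> (src S x) = src G (\<Psi> x)" "\<Psi> (tgt S x) = tgt G (\<Psi> x)"
      unfolding x(1) Psi_src[OF x(2,3)] Psi_tgt[OF x(2,3)] S_src[OF x(2)] S_tgt[OF x(2)]
        free_src_pi[OF x(2)] free_tgt_pi[OF x(2)]
      using id src_obj[OF p] tgt_obj[OF p] by auto
  next
    fix x y assume "x \<in> arr S" "y \<in> arr S"
    then obtain X a Y b where x: "x = (X, a)" "X \<in> arr F" "a \<in> carrier (fib A (tgt Q (free_pi Q X)))"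
      and y: "y = (Y, b)" "Y \<in> arr F" "b \<in> carrier (fib A (tgt Q (free_pi Q Y)))"
      by (cases x; cases y) (auto simp: S_arr)
    let ?s = "tgt Q (free_pi Q X)" and ?t = "tgt Q (free_pi Q Y)"
    note px = piD(1)[OF x(2)] and py = piD(1)[OF y(2)]
    note s = tgt_obj[OF px] and t = tgt_obj[OF py]
    show "\<Psi> (comp S x y) = comp G (\<Psi> x) (\<Psi> y)" if "tgt S x = src S y"
    proof -
      have c: "tgt F X = src F Y" using that x y by (simp add: S_tgt S_src)
      have st: "?s = src Q (free_pi Q Y)" using c piD(3)[OF x(2)] piD(2)[OF y(2)] by simp
      have pxy: "tgt Q (free_pi Q (comp F X Y)) = ?t"
        using piD(4)[OF x(2) y(2) c] px py st by (simp add: tgt_comp)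
      let ?a' = "lact Q A a (free_pi Q Y)"
      have a': "?a' \<in> carrier (fib A ?t)"
        using hom_in_carrier[OF lact_hom[OF py]] x(3) st by simp
      let ?iX = "\<iota> (?s, a)" and ?ia = "\<iota> (?t, ?a')" and ?iY = "\<iota> (?t, b)"
      have arrs: "?iX \<in> arr G" "?ia \<in> arr G" "?iY \<in> arr G" "\<psi> X \<in> arr G" "\<psi> Y \<in> arr G"
        using iota_arr s t x y a' psiD(1) by auto
      note ends = iota_ends[OF s x(3)] iota_ends[OF t a'] iota_ends[OF t y(3)]
        psi_ends[OF x(2)] psi_ends[OF y(2)]
      have swap: "comp G ?iX (\<psi> Y) = comp G (\<psi> Y) ?ia"
        using iota_commute[of "\<psi> Y" a] arrs(5) phi_psi[OF y(2)] st x(3) by simp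
      have "\<Psi> (comp S x y) = comp G (comp G (\<psi> X) (\<psi> Y)) (comp G ?ia ?iY)"
        using x y pxy by (simp add: S_comp psiD(4) c iota_mult[OF t a' y(3)])
      also have "\<dots> = comp G (\<psi> X) (comp G (comp G (\<psi> Y) ?ia) ?iY)"
        using arrs ends st by (simp add: G.comp_assoc G.comp_closed G.src_comp G.tgt_comp)
      also have "\<dots> = comp G (comp G (\<psi> X) ?iX) (comp G (\<psi> Y) ?iY)"
        unfolding swap[symmetric]
        using arrs ends st by (simp add: G.comp_assoc G.comp_closed G.src_comp G.tgt_comp)
      finally show ?thesis using x y by simp
    qed
    show "le G (\<Psi> x) (\<Psi> y)" if "le S x y"
    proof -
      have le: "le F X Y" "le F (tgt F X) (tgt F Y)" "a = act A b (?t, ?s)"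
        using that x y by (simp_all add: S_le)
      have "?s \<sqsubseteq> ?t"
        using tgt_mono[OF px py piD(5)[OF x(2) y(2) le(1)]] .
      then have "le G (\<iota> (?s, a)) (\<iota> (?t, b))"
        using le(3) s t x(3) y(3) by (intro iotaD(5)) simp_all
      then show ?thesis
        using x y s t psiD(5)[OF x(2) y(2) le(1)] iota_ends psi_ends iota_arr psiD(1)
        by (simp add: G.OG2)
    qed
  qed
qed

text \<open>An arrow \<open>g\<close> over \<open>q\<close> and the lift of the one-letter word \<open>\<lfloor>q\<rfloor>\<close> differ by an arrow over an
  identity, hence by an element of the module.\<close>

lemma Psi_surj: "\<Psi> ` arr S = arr G"
proof
  show "\<Psi> ` arr S \<subseteq> arr G" using ordered_functorD(1)[OF Psi_functor] by auto
  show "arr G \<subseteq> \<Psi> ` arr S"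
  proof
    fix g assume g: "g \<in> arr G"
    let ?q = "\<phi> g"
    have q: "?q \<in> arr Q" using phiD(1)[OF g] .
    let ?l = "Fwd (src Q ?q) ?q"
    have l: "letter_ok Q ?l" using q src_obj by (simp add: le_refl obj_arr)
    let ?X = "path_class Q (src Q ?q, [?l])"
    have X: "?X \<in> arr F" using is_path_single[OF l] by (simp add: free_arrI)
    have r: "rst Q (src Q ?q) ?q = ?q" using rst_eqI[OF q q le_refl[OF q]] .
    have pX: "free_pi Q ?X = ?q"
      using tgt_unit[OF q] by (simp add: free_pi_eq pi.free_ext_class r)
    have psi: "\<psi> ?X \<in> arr G" "\<phi> (\<psi> ?X) = ?q" using psiD(1)[OF X] phi_psi[OF X] pX by auto
    have s: "src G (\<psi> ?X) = src G g" using src_unit_phi[OF g] src_unit_phi[OF psi(1)] psi(2) by simp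
    let ?k = "comp G (ginv G (\<psi> ?X)) g"
    have k: "?k \<in> arr G" using g psi s by (simp add: G.comp_closed G.ginv_closed G.tgt_ginv)
    have "\<phi> ?k = tgt Q ?q"
      using g psi s q functor_ginv[OF G.groupoid_axioms groupoid_axioms phi_functor psi(1)]
      by (simp add: phiD(4) G.ginv_closed G.tgt_ginv ginv_comp)
    then obtain a where a: "a \<in> carrier (fib A (tgt Q ?q))" "?k = \<iota> (tgt Q ?q, a)"
      using over_objectE[OF k] tgt_obj[OF q] by metis
    have "\<Psi> (?X, a) = comp G (\<psi> ?X) ?k" using a pX by simp
    also have "\<dots> = g" using G.comp_ginv_comp[OF psi(1) g s] .
    finally have "\<Psi> (?X, a) = g" .
    moreover have "(?X, a) \<in> arr S" using X a pX by (simp add: S_arr)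
    ultimately show "g \<in> \<Psi> ` arr S" by (metis image_eqI)
  qed
qed

lemma Psi_inj_obj: "inj_on \<Psi> (objs S)"
proof (rule inj_on_inverseI)
  fix x assume x: "x \<in> objs S"
  obtain X a where xa: "x = (X, a)" by (cases x)
  have X: "X \<in> arr F" "a \<in> carrier (fib A (tgt Q (free_pi Q X)))"
    using S.obj_arr[OF x] xa by (auto simp: S_arr)
  let ?e = "src Q (free_pi Q X)"
  have e: "?e \<in> objs Q" using src_obj piD(1) X by simp
  have eq: "x = (free_id Q ?e, \<one>\<^bsub>fib A ?e\<^esub>)"
    using S.src_of_obj[OF x] xa S_src[OF X(1)] free_src_pi[OF X(1)] by simp
  then have "\<phi> (\<Psi> x) = ?e" using Psi_id[OF e] phi_iota e fib(3) by simp
  then show "(free_id Q (\<phi> (\<Psi> x)), \<one>\<^bsub>fib A (\<phi> (\<Psi> x))\<^esub>) = x" using eq by simp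
qed

text \<open>For \<open>X\<close> in \<open>kernel Q\<close> with \<open>\<psi> X = \<iota> (e, c)\<close> the value \<open>\<Psi> (X, a)\<close> is \<open>\<iota> (e, c + a)\<close>, an identity
  exactly for \<open>a = - c\<close>.\<close>

lemma graph_sub_kernel: "graph_sub Q \<alpha> = {x \<in> arr S. \<Psi> x \<in> objs G}"
proof -
  have "(X, a) \<in> graph_sub Q \<alpha> \<longleftrightarrow> (X, a) \<in> arr S \<and> \<Psi> (X, a) \<in> objs G" for X a
  proof (cases "X \<in> kernel Q")
    case True
    let ?e = "free_pi Q X"
    note x = kernel_arr[OF True] kernel_obj[OF True] coord[OF True]
    have grp: "group (fib A ?e)" using fib x by simp
    have arr: "(X, a) \<in> arr S \<longleftrightarrow> a \<in> carrier (fib A ?e)"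
      using x by (simp add: S_arr tgt_of_obj)
    have "\<Psi> (X, a) \<in> objs G \<longleftrightarrow> a = inv\<^bsub>fib A ?e\<^esub> coord X" if a: "a \<in> carrier (fib A ?e)"
    proof -
      have P: "\<Psi> (X, a) = \<iota> (?e, coord X \<otimes>\<^bsub>fib A ?e\<^esub> a)"
        using x a iota_mult by (simp add: tgt_of_obj)
      have m: "coord X \<otimes>\<^bsub>fib A ?e\<^esub> a \<in> carrier (fib A ?e)"
        using x a grp by (simp add: group.is_monoid monoid.m_closed)
      have "\<Psi> (X, a) \<in> objs G \<longleftrightarrow> \<Psi> (X, a) = unit ?e"
        using unit_phi[of "\<Psi> (X, a)"] unit_obj[OF x(2)] P m phi_iota x(2) by auto
      also have "\<dots> \<longleftrightarrow> coord X \<otimes>\<^bsub>fib A ?e\<^esub> a = \<one>\<^bsub>fib A ?e\<^esub>"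
        unfolding P unit_def using iota_eq_iff x(2) m fib(3) by simp
      also have "\<dots> \<longleftrightarrow> a = inv\<^bsub>fib A ?e\<^esub> coord X"
        using group.inv_solve_left[OF grp, of a "coord X" "\<one>\<^bsub>fib A ?e\<^esub>"] x a grp
        by (auto simp: group.inv_closed group.is_monoid monoid.r_one monoid.one_closed)
      finally show ?thesis .
    qed
    moreover have "(X, a) \<in> graph_sub Q \<alpha> \<longleftrightarrow> a = inv\<^bsub>fib A ?e\<^esub> coord X"
      using True by (simp add: graph_sub_def \<alpha>_def)
    ultimately show ?thesis using arr x(3) group.inv_closed[OF grp] by auto
  next
    case False
    then show ?thesis
      using phi_Psi[of X a] phi_obj[of "\<Psi> (X, a)"] kernelI[of X] by (auto simp: S_arr graph_sub_def)
  qed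
  then show ?thesis by auto
qed

text \<open>Restrict \<open>y\<close> to the source of \<open>g\<close>.  The image of the result and \<open>g\<close> are two arrows below \<open>\<Psi> y\<close>
  with the same source, hence equal.\<close>

lemma Psi_le_lift:
  assumes g: "g \<in> arr G" and y: "y \<in> arr S" and le: "le G g (\<Psi> y)"
  shows "\<exists>x \<in> arr S. le S x y \<and> \<Psi> x = g"
proof -
  obtain Y b where yb: "y = (Y, b)" "Y \<in> arr F" "b \<in> carrier (fib A (tgt Q (free_pi Q Y)))"
    using y by (cases y) (auto simp: S_arr)
  let ?e = "src Q (\<phi> g)" and ?f = "src Q (free_pi Q Y)" and ?t = "tgt Q (free_pi Q Y)"
  have Py: "\<Psi> y \<in> arr G" "\<phi> (\<Psi> y) = free_pi Q Y" using Psi[OF yb(2,3)] yb(1) by auto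
  have pg: "\<phi> g \<in> arr Q" and py: "free_pi Q Y \<in> arr Q" using phiD(1)[OF g] piD(1)[OF yb(2)] .
  have "?e \<sqsubseteq> ?f"
    using src_mono[OF pg py] phiD(5)[OF g Py(1) le] Py(2) by simp
  then obtain X where X: "X \<in> arr F" "le F X Y" "src F X = free_id Q ?e" "le F (tgt F X) (tgt F Y)"
    using free_restriction[OF yb(2) src_obj[OF pg] src_obj[OF py] free_src_pi[OF yb(2)]] by blast
  let ?s = "tgt Q (free_pi Q X)"
  have px: "free_pi Q X \<in> arr Q" using piD(1)[OF X(1)] .
  have "?s \<sqsubseteq> ?t" using tgt_mono[OF px py piD(5)[OF X(1) yb(2) X(2)]] .
  then have a: "act A b (?t, ?s) \<in> carrier (fib A ?s)"
    using hom_in_carrier[OF act_restriction_hom] tgt_obj px py yb(3) by blast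
  let ?x = "(X, act A b (?t, ?s))"
  have x: "?x \<in> arr S" "le S ?x y" using X yb a by (simp_all add: S_arr S_le)
  have "src Q (free_pi Q X) = ?e"
    using piD(2)[OF X(1)] X(3) free_pi_id[of ?e] by simp
  then have "src G (\<Psi> ?x) = src G g" using Psi_src[OF X(1) a] src_unit_phi[OF g] by simp
  then have "\<Psi> ?x = g"
    using G.below_eq_src[OF Psi_arr[OF X(1) a] g Py(1)] ordered_functorD(5)[OF Psi_functor x(1) y x(2)] le
    by simp
  then show ?thesis using x by blast
qed

sublocale quot: kernel_quotient S G \<Psi> "graph_sub Q \<alpha>"
proof
  fix x assume "x \<in> arr S"
  then obtain X a where x: "x = (X, a)" "X \<in> arr F" "a \<in> carrier (fib A (tgt Q (free_pi Q X)))"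
    by (cases x) (auto simp: S_arr)
  have act: "act A a (tgt Q (free_pi Q X), tgt Q (free_pi Q X)) = a"
    using lact_obj[OF tgt_obj[OF piD(1)[OF x(2)]] x(3)] tgt_obj[OF piD(1)[OF x(2)]]
    by (simp add: lact_def src_of_obj)
  interpret F: groupoid F by (rule free_groupoid)
  show "le S x x"
    using x act free_le_refl[OF x(2)] free_le_refl[OF F.obj_arr[OF F.tgt_obj[OF x(2)]]]
    by (simp add: S_le)
  fix y assume "y \<in> arr S" "le S y x" "tgt S y = tgt S x"
  moreover obtain Y b where y: "y = (Y, b)" by (cases y)
  ultimately have Y: "Y \<in> arr F" "le F Y X" "tgt F Y = tgt F X"
    "b = act A a (tgt Q (free_pi Q X), tgt Q (free_pi Q Y))"
    using x by (auto simp: S_arr S_le S_tgt)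
  then have "Y = X" using free_below_eq_tgt x(2) by blast
  then show "y = x" using x(1) y Y(4) act by simp
qed (use Psi_functor Psi_surj Psi_inj_obj graph_sub_kernel Psi_le_lift in auto)

lemma equivalent_to_E:
  "equivalent_extensions Q A G \<iota> \<phi> (E_ogpd Q A \<alpha>) (E_iota Q A \<alpha>) (E_phi Q)"
proof -
  interpret iso: ogpd_isomorphism G "E_ogpd Q A \<alpha>" quot.fibre
    using quot.fibre_iso by unfold_locales (simp add: E_ogpd_def)
  show ?thesis
  proof (rule iso.extension_transport[OF ext])
    fix x assume "x \<in> arr M"
    then obtain e a where x: "x = (e, a)" "e \<in> objs Q" "a \<in> carrier (fib A e)" by (cases x) auto
    have "(free_id Q e, a) \<in> arr S"
      using x by (simp add: S_arr free_id_arr free_pi_id tgt_of_obj)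
    then show "E_iota Q A \<alpha> x = quot.fibre (\<iota> x)"
      using quot.quot_class_eq Psi_id[OF x(2,3)] x(1) by (simp add: E_iota_def del: \<Psi>.simps)
  next
    fix g assume g: "g \<in> arr G"
    show "E_phi Q (quot.fibre g) = \<phi> g"
      unfolding E_phi_def
    proof (rule the_elem_image)
      show "quot.fibre g \<noteq> {}" using quot.fibre_nonempty[OF g] by blast
      show "(case x of (X, a) \<Rightarrow> free_pi Q X) = \<phi> g" if "x \<in> quot.fibre g" for x
        using that phi_Psi by (cases x) (auto simp: quot.fibre_def S_arr simp del: \<Psi>.simps)
    qed
  qed (fact mod_groupoid gmodule ordered_groupoid_axioms)+
qed

end

section \<open>Every extension comes from an equivariant functor\<close>

theorem proposition5p4:
  fixes Q :: "'q ogpd" and A :: "('q, 'm) gmodule"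
    and G :: "'g ogpd" and \<iota> :: "'q \<times> 'm \<Rightarrow> 'g" and \<phi> :: "'g \<Rightarrow> 'q"
  assumes "ordered_groupoid Q"
    and "is_gmodule Q A"
    and "extension Q A G \<iota> \<phi>"
  shows "\<exists>\<alpha> \<in> kernel_homs Q A.
    equivalent_extensions Q A G \<iota> \<phi> (E_ogpd Q A \<alpha>) (E_iota Q A \<alpha>) (E_phi Q)"
proof -
  have "ordered_groupoid G" using assms(3) by (simp add: extension_def)
  then interpret module_extension Q A G \<iota> \<phi>
    using assms by (intro module_extension.intro module_extension_axioms.intro ogpd_paths.intro
        ogpd_module.intro ogpd_module_axioms.intro)
  show ?thesis using alpha_kernel_hom equivalent_to_E by blast
qed

end
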